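(* If $n\ge 4$, then $$\mathrm{vv}(P_n\,\square\,C_n)=\begin{cases}\frac{n^2+3}{2}, & n\equiv 1 \pmod 4,\\[2pt] \frac{n^2+n-2}{2}, & n\equiv 3 \pmod 4,\\[2pt] \frac{2n^2+n}{4}, & n\equiv 0 \pmod 4,\\[2pt] \frac{2n^2+n-2}{4}, & n\equiv 2 \pmod 4.\end{cases}$$
   Context: $P_n$ is the path and $C_n$ the cycle on $n$ vertices. The Cartesian product $G\,\square\,H$ has vertex set $V(G)\times V(H)$, with $(g,h)$ adjacent to $(g',h')$ iff either $gg'\in E(G)$ and $h=h'$, or $g=g'$ and $hh'\in E(H)$. For a connected graph $X$ and $x\in V(X)$, a set $S\subseteq V(X)\setminus\{x\}$ is an $x$-visibility set if for every $y\in S$ there exists a shortest $x,y$-path $P$ with $V(P)\cap S=\{y\}$; $v_x(X)$ is the maximum size of an $x$-visibility set and $\mathrm{vv}(X)=\max_{x\in V(X)} v_x(X)$. *)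

theory Defs
  imports Complex_Main "Graph_Theory.Graph_Theory"
begin

text \<open>
  Simple graphs are symmetric loop-free digraphs without parallel arcs
  (locale \<open>pair_graph\<close>): an edge between \<open>u\<close> and \<open>v\<close> is the pair of arcs
  \<open>(u, v)\<close>, \<open>(v, u)\<close>. Paths are vertex lists (\<open>vpath\<close>).
\<close>

definition path_graph :: "nat \<Rightarrow> nat pair_pre_digraph" where
  "path_graph n =
    \<lparr>pverts = {..<n},
     parcs = {(i, j). i < n \<and> j < n \<and> (j = Suc i \<or> i = Suc j)}\<rparr>"

text \<open>The cycle is meant for \<open>n \<ge> 3\<close>; for \<open>n = 1\<close> the definition yields a loop.\<close>

definition cycle_graph :: "nat \<Rightarrow> nat pair_pre_digraph" where
  "cycle_graph n =
    \<lparr>pverts = {..<n},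
     parcs = {(i, j). i < n \<and> j < n \<and> (j = Suc i mod n \<or> i = Suc j mod n)}\<rparr>"

definition cartesian_product ::
    "'a pair_pre_digraph \<Rightarrow> 'b pair_pre_digraph \<Rightarrow> ('a \<times> 'b) pair_pre_digraph"
    (infixl \<open>\<box>\<close> 70) where
  "G \<box> H =
    \<lparr>pverts = pverts G \<times> pverts H,
     parcs = {((g, h), (g', h')).
       (g, h) \<in> pverts G \<times> pverts H \<and> (g', h') \<in> pverts G \<times> pverts H \<and>
       ((g, g') \<in> parcs G \<and> h = h' \<or> g = g' \<and> (h, h') \<in> parcs H)}\<rparr>"

definition shortest_vpath ::
    "('a, 'b) pre_digraph \<Rightarrow> 'a \<Rightarrow> 'a \<Rightarrow> 'a vwalk \<Rightarrow> bool" where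
  "shortest_vpath X x y p \<longleftrightarrow>
    vpath p X \<and> hd p = x \<and> last p = y \<and>
    (\<forall>q. vpath q X \<and> hd q = x \<and> last q = y \<longrightarrow> vwalk_length p \<le> vwalk_length q)"

definition visibility_set :: "('a, 'b) pre_digraph \<Rightarrow> 'a \<Rightarrow> 'a set \<Rightarrow> bool" where
  "visibility_set X x S \<longleftrightarrow>
    S \<subseteq> verts X - {x} \<and>
    (\<forall>y\<in>S. \<exists>p. shortest_vpath X x y p \<and> set p \<inter> S = {y})"

text \<open>
  Both maxima below are taken over finite nonempty sets whenever \<open>X\<close> is finite and
  nonempty (the empty set is always a visibility set); \<open>Max\<close> is unspecified otherwise.
\<close>

definition visibility_number_at :: "('a, 'b) pre_digraph \<Rightarrow> 'a \<Rightarrow> nat" where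
  "visibility_number_at X x = Max {card S |S. visibility_set X x S}"

definition vv :: "('a, 'b) pre_digraph \<Rightarrow> nat" where
  "vv X = Max {visibility_number_at X x |x. x \<in> verts X}"

end

theory Submission
  imports Defs
begin

text \<open>
  Fix a root \<open>x\<close> and call \<open>u\<close> a parent of \<open>v\<close> if \<open>u\<close> precedes \<open>v\<close> on a shortest path from \<open>x\<close>.
  Given an \<open>x\<close>-visibility set \<open>S\<close>, call a vertex clear if some shortest path from \<open>x\<close> to it
  avoids \<open>S\<close>. Charge every \<open>v \<noteq> x\<close> to a clear parent if it has one, and to itself otherwise. All
  charges lie outside \<open>S\<close>, and distinct vertices with the same charge have it as a common parent.
  Hence a packing, i.e. a set of vertices no two of which have a common parent, has at most
  \<open>\<bar>V\<bar> - \<bar>S\<bar>\<close> elements, and a block of \<open>2 m + 1\<close> further vertices no three of which have a common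
  parent improves this by \<open>m + 1\<close>. An explicit packing with at most two blocks gives the upper bound
  for every root.

  Conversely, if \<open>R\<close> contains \<open>x\<close> and a parent of every other vertex, then \<open>V - R\<close> is an
  \<open>x\<close>-visibility set. Rooted at distance 1 from an end of the path, the smallest such \<open>R\<close> consists of
  alternate rows (\<open>n \<equiv> 1\<close> modulo 4), of alternate columns (\<open>n \<equiv> 3\<close>), or of alternate columns that
  turn into alternate rows beyond the diagonals through the far end of the root's column (\<open>n\<close> even).
\<close>

section \<open>Visibility sets and level functions\<close>

text \<open>These properties force \<open>level\<close> to be the distance from \<open>x\<close>, as
  \<open>shortest_vpath_iff\<close> confirms. The grid can thus supply an explicit formula without
  any computation of shortest paths.\<close>

locale level_function =
  fixes X :: "('a, 'b) pre_digraph" and x :: 'a and level :: "'a \<Rightarrow> nat"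
  assumes root_in_verts: "x \<in> verts X"
    and level_root: "level x = 0"
    and level_arc: "(u, v) \<in> arcs_ends X \<Longrightarrow> level v \<le> Suc (level u)"
    and ex_lower_neighbour:
      "v \<in> verts X \<Longrightarrow> v \<noteq> x \<Longrightarrow>
        \<exists>u \<in> verts X. (u, v) \<in> arcs_ends X \<and> level v = Suc (level u)"
begin

section \<open>Parents, clear vertices and shortest paths\<close>

definition parent :: "'a \<Rightarrow> 'a \<Rightarrow> bool" where
  "parent u v \<longleftrightarrow>
    u \<in> verts X \<and> v \<in> verts X \<and> (u, v) \<in> arcs_ends X \<and> level v = Suc (level u)"

inductive clear :: "'a set \<Rightarrow> 'a \<Rightarrow> bool" for S where
  root: "clear S x"
| step: "clear S u \<Longrightarrow> parent u v \<Longrightarrow> v \<notin> S \<Longrightarrow> clear S v"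

lemma clear_in_verts: "clear S v \<Longrightarrow> v \<in> verts X"
  by (induction rule: clear.induct) (auto simp: root_in_verts parent_def)

lemma clear_notin: "clear S v \<Longrightarrow> x \<notin> S \<Longrightarrow> v \<notin> S"
  by (induction rule: clear.induct) auto

lemma level_last_le:
  assumes "vwalk p X"
  shows "level (last p) \<le> level (hd p) + vwalk_length p"
  using assms
proof (induction p rule: vwalk_induct)
  case (Cons u v es)
  then show ?case using level_arc[of u v] by (auto simp del: vwalk_length_simp simp: vwalk_length_def)
qed auto

lemma vwalk_snoc:
  assumes "vwalk p X" "(last p, v) \<in> arcs_ends X" "v \<in> verts X"
  shows "vwalk (p @ [v]) X"
  using assms by (auto simp: vwalk_def vwalk_arcs_append)

text \<open>A clear vertex is appended to the path of its parent. The bound on the levels along the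
  path is carried through the induction because it makes the new vertex, one level higher, distinct
  from all earlier ones.\<close>

lemma vpath_of_clear:
  assumes "clear S v" "x \<notin> S"
  shows "\<exists>p. vpath p X \<and> hd p = x \<and> last p = v \<and> vwalk_length p = level v \<and>
    set p \<inter> S = {} \<and> (\<forall>w \<in> set p. level w \<le> level v)"
  using assms(1)
proof (induction rule: clear.induct)
  case root
  have "vpath [x] X" using root_in_verts by (auto simp: vpath_def vwalk_def)
  then show ?case using assms(2) level_root by (intro exI[of _ "[x]"]) auto
next
  case (step u v)
  then obtain p where p: "vpath p X" "hd p = x" "last p = u" "vwalk_length p = level u"
      "set p \<inter> S = {}" "\<forall>w \<in> set p. level w \<le> level u"
    by blast
  have "p \<noteq> []" using p(1) by (auto simp: vpath_def vwalk_def)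
  moreover from this have "length p = Suc (level u)" using p(4) by (cases p) auto
  moreover have "v \<notin> set p" using p(6) step(2) by (auto simp: parent_def)
  moreover have "vwalk (p @ [v]) X"
    using p step(2) by (intro vwalk_snoc) (auto simp: parent_def vpath_def)
  ultimately show ?case using p step
    by (intro exI[of _ "p @ [v]"]) (auto simp: vpath_def parent_def Suc_le_eq le_SucI)
qed

lemma vpath_via_clear_parent:
  assumes "clear S u" "x \<notin> S" "parent u v"
  shows "\<exists>p. vpath p X \<and> hd p = x \<and> last p = v \<and> vwalk_length p = level v \<and> set p \<inter> S \<subseteq> {v}"
proof -
  obtain p where p: "vpath p X" "hd p = x" "last p = u" "vwalk_length p = level u"
      "set p \<inter> S = {}" "\<forall>w \<in> set p. level w \<le> level u"
    using vpath_of_clear[OF assms(1,2)] by blast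
  have "p \<noteq> []" using p(1) by (auto simp: vpath_def vwalk_def)
  moreover from this have "length p = Suc (level u)" using p(4) by (cases p) auto
  moreover have "v \<notin> set p" using p(6) assms(3) by (auto simp: parent_def)
  moreover have "vwalk (p @ [v]) X"
    using p assms(3) by (intro vwalk_snoc) (auto simp: parent_def vpath_def)
  ultimately show ?thesis using p assms
    by (intro exI[of _ "p @ [v]"]) (auto simp: vpath_def parent_def)
qed

lemma clear_empty:
  assumes "v \<in> verts X"
  shows "clear {} v"
  using assms
proof (induction "level v" arbitrary: v rule: less_induct)
  case less
  show ?case
  proof (cases "v = x")
    case False
    then obtain u where u: "parent u v"
      using ex_lower_neighbour less.prems by (auto simp: parent_def)
    then have "clear {} u" using less.hyps[of u] by (simp add: parent_def)
    then show ?thesis using u by (metis clear.step empty_iff)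
  qed (simp add: clear.root)
qed

text \<open>A walk of length \<open>k\<close> climbs at most \<open>k\<close> levels, so no path to
  \<open>v\<close> is shorter than \<open>level v\<close>. This length is attained because every
  vertex is clear with respect to the empty set.\<close>

lemma shortest_vpath_iff:
  assumes "v \<in> verts X"
  shows "shortest_vpath X x v p \<longleftrightarrow>
    vpath p X \<and> hd p = x \<and> last p = v \<and> vwalk_length p = level v"
proof -
  obtain q where q: "vpath q X" "hd q = x" "last q = v" "vwalk_length q = level v"
    using vpath_of_clear[OF clear_empty[OF assms]] by auto
  have lower: "level v \<le> vwalk_length p" if "vpath p X" "hd p = x" "last p = v" for p
    using level_last_le[of p] that level_root by (auto simp: vpath_def)
  show ?thesis
  proof
    assume "shortest_vpath X x v p"
    then have p: "vpath p X" "hd p = x" "last p = v"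
        and min: "\<And>q. vpath q X \<and> hd q = x \<and> last q = v \<Longrightarrow> vwalk_length p \<le> vwalk_length q"
      by (simp_all only: shortest_vpath_def)
    then show "vpath p X \<and> hd p = x \<and> last p = v \<and> vwalk_length p = level v"
      using lower[of p] min[of q] p q by (simp del: vwalk_length_simp)
  next
    assume p: "vpath p X \<and> hd p = x \<and> last p = v \<and> vwalk_length p = level v"
    have "vwalk_length p \<le> vwalk_length q" if "vpath q X \<and> hd q = x \<and> last q = v" for q
      using lower[of q] that p by linarith
    with p show "shortest_vpath X x v p"
      unfolding shortest_vpath_def by blast
  qed
qed

text \<open>A path from \<open>x\<close> whose length is the level of its end climbs one level with
  every arc. So each of its vertices is a parent of the next one, and every prefix has the same
  property; the vertices before the last avoid \<open>S\<close> and are therefore clear.\<close>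

lemma clear_parent_of_vwalk:
  assumes "vwalk p X" "distinct p" "hd p = x" "vwalk_length p = level (last p)"
    and "set p \<inter> S \<subseteq> {last p}" "last p \<noteq> x"
  shows "\<exists>u. clear S u \<and> parent u (last p)"
  using assms
proof (induction p rule: rev_induct)
  case (snoc v q)
  show ?case
  proof (cases "q = []")
    case False
    have "vwalk_arcs (q @ [v]) = vwalk_arcs q @ [(last q, v)]"
      using False by (simp add: vwalk_arcs_append)
    then have walk: "vwalk q X" and arc: "(last q, v) \<in> arcs_ends X"
      using snoc.prems(1) False by (simp_all add: vwalk_def)
    have hd: "hd q = x" using snoc.prems(3) False by simp
    have len: "vwalk_length q = level (last q)" and lev: "level v = Suc (level (last q))"
      using level_last_le[OF walk] level_arc[OF arc] snoc.prems(4) False hd level_root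
      by (cases q; simp)+
    have "set q \<inter> S = {}" using snoc.prems(2,5) by auto
    have "parent (last q) v"
      using arc lev walk snoc.prems(1) False by (simp add: parent_def vwalk_def subset_iff)
    moreover have "clear S (last q)"
    proof (cases "last q = x")
      case False
      have "last q \<notin> S" using \<open>set q \<inter> S = {}\<close> \<open>q \<noteq> []\<close> by (auto dest: last_in_set)
      then show ?thesis
        using snoc.IH[OF walk _ hd len _ False] snoc.prems(2) \<open>set q \<inter> S = {}\<close>
        by (metis clear.step distinct_append empty_subsetI)
    qed (simp add: clear.root)
    ultimately show ?thesis by auto
  qed (use snoc.prems in auto)
qed auto

section \<open>Visibility sets in terms of clear parents\<close>

lemma visibility_set_iff:
  "visibility_set X x S \<longleftrightarrow>
    S \<subseteq> verts X - {x} \<and> (\<forall>y \<in> S. \<exists>u. clear S u \<and> parent u y)"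
proof (intro iffI conjI ballI)
  assume vis: "visibility_set X x S"
  then show sub: "S \<subseteq> verts X - {x}" by (auto simp: visibility_set_def)
  fix y assume y: "y \<in> S"
  with vis obtain p where p: "shortest_vpath X x y p" "set p \<inter> S = {y}"
    by (auto simp: visibility_set_def)
  then have "vpath p X" "hd p = x" "last p = y" "vwalk_length p = level y"
    using shortest_vpath_iff[of y p] y sub by auto
  then show "\<exists>u. clear S u \<and> parent u y"
    using clear_parent_of_vwalk[of p S] p(2) y sub by (auto simp: vpath_def)
next
  assume *: "S \<subseteq> verts X - {x} \<and> (\<forall>y \<in> S. \<exists>u. clear S u \<and> parent u y)"
  have "\<exists>p. shortest_vpath X x y p \<and> set p \<inter> S = {y}" if y: "y \<in> S" for y
  proof -
    obtain u where "clear S u" "parent u y" using * y by blast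
    then obtain p where p: "vpath p X" "hd p = x" "last p = y" "vwalk_length p = level y"
        "set p \<inter> S \<subseteq> {y}"
      using vpath_via_clear_parent[of S u y] * by blast
    then have "y \<in> set p" by (auto simp: vpath_def vwalk_def)
    then show ?thesis using p shortest_vpath_iff[of y p] * y by auto
  qed
  then show "visibility_set X x S" using * by (auto simp: visibility_set_def)
qed

text \<open>By induction on the level, every vertex outside \<open>S\<close> is clear. The parent
  outside \<open>S\<close> is then a clear parent.\<close>

lemma visibility_set_if_parent_notin:
  assumes "S \<subseteq> verts X - {x}"
    and "\<And>v. v \<in> verts X \<Longrightarrow> v \<noteq> x \<Longrightarrow> \<exists>u. parent u v \<and> u \<notin> S"
  shows "visibility_set X x S"
proof -
  have clear: "clear S v" if "v \<in> verts X" "v \<notin> S" for v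
    using that
  proof (induction "level v" arbitrary: v rule: less_induct)
    case less
    show ?case
    proof (cases "v = x")
      case False
      then obtain u where u: "parent u v" "u \<notin> S" using assms(2)[OF less.prems(1)] by metis
      then have "clear S u" using less.hyps[of u] by (simp add: parent_def)
      then show ?thesis using u less.prems by (metis clear.step)
    qed (simp add: clear.root)
  qed
  have "\<exists>u. clear S u \<and> parent u y" if "y \<in> S" for y
    using assms(2)[of y] that assms(1) clear by (auto simp: parent_def)
  then show ?thesis using assms(1) by (simp add: visibility_set_iff)
qed

text \<open>\<open>f\<close> chooses a clear parent, or the vertex itself if there is none. Both
  values avoid \<open>S\<close>, since clear vertices do and elements of \<open>S\<close> have a
  clear parent. A vertex charged to itself is not clear, hence not the charge of any other vertex;
  so colliding vertices are both charged to a common parent.\<close>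

lemma visibility_set_charging:
  assumes "visibility_set X x S"
  shows "\<exists>f. \<forall>v \<in> verts X - {x}. f v \<in> verts X - S \<and>
    (\<forall>w \<in> verts X - {x}. f v = f w \<longrightarrow> v \<noteq> w \<longrightarrow> parent (f v) v)"
proof -
  define f where "f v = (if \<exists>u. clear S u \<and> parent u v then SOME u. clear S u \<and> parent u v else v)" for v
  have S: "S \<subseteq> verts X - {x}" and visible: "\<And>y. y \<in> S \<Longrightarrow> \<exists>u. clear S u \<and> parent u y"
    using assms by (simp_all add: visibility_set_iff)
  have pos: "clear S (f v) \<and> parent (f v) v" if "\<exists>u. clear S u \<and> parent u v" for v
    using someI_ex[OF that] that by (simp add: f_def)
  have neg: "f v = v \<and> \<not> clear S v \<and> v \<notin> S"
    if "\<not> (\<exists>u. clear S u \<and> parent u v)" "v \<noteq> x" for v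
  proof -
    have "\<not> clear S v" using that by (auto elim: clear.cases)
    then show ?thesis using that visible[of v] by (auto simp: f_def)
  qed
  have "f v \<in> verts X - S" if "v \<in> verts X - {x}" for v
  proof (cases "\<exists>u. clear S u \<and> parent u v")
    case True
    then show ?thesis using pos[of v] clear_in_verts clear_notin[of S "f v"] S by auto
  next
    case False
    then show ?thesis using neg[of v] that by auto
  qed
  moreover have "parent (f v) v"
    if "v \<in> verts X - {x}" "w \<in> verts X - {x}" "f v = f w" "v \<noteq> w" for v w
  proof (rule ccontr)
    assume "\<not> parent (f v) v"
    then have "f v = v" "\<not> clear S v" using pos[of v] neg[of v] that(1) by auto
    then show False using pos[of w] neg[of w] that by (cases "\<exists>u. clear S u \<and> parent u w") auto
  qed
  ultimately show ?thesis by (intro exI[of _ f]) simp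
qed

end

section \<open>Coordinates relative to a root\<close>

text \<open>
  A vertex is described by its signed distances from the root along the path and along the
  cycle, the latter in \<open>{- L..M}\<close>. For even \<open>n\<close> the antipodal column \<open>M = L + 1\<close> is also
  entered from the column \<open>- L\<close>; this is the only wrap-around step away from the root.
\<close>

definition child :: "int \<Rightarrow> int \<Rightarrow> int \<times> int \<Rightarrow> int \<times> int \<Rightarrow> bool" where
  "child L M = (\<lambda>(s, c) (t, b).
    (b = c \<and> (0 \<le> s \<and> t = s + 1 \<or> s \<le> 0 \<and> t = s - 1)) \<or>
    (t = s \<and> (0 \<le> c \<and> b = c + 1 \<or> c \<le> 0 \<and> b = c - 1 \<or> c = - L \<and> b = M \<and> M = L + 1)))"

text \<open>The sign \<sigma> orients the path: the value \<open>- 1\<close> reflects it, which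
  allows the shorter side of the root to be the one with negative rows.\<close>

locale rooted_grid =
  fixes n r c :: nat and \<sigma> :: int
  assumes n_ge: "n \<ge> 3" and r_less: "r < n" and c_less: "c < n"
    and sign: "\<sigma> = 1 \<or> \<sigma> = - 1"
begin

definition L :: int where "L = int ((n - 1) div 2)"
definition M :: int where "M = int (n div 2)"
definition lo :: int where "lo = (if \<sigma> = 1 then int r else int n - 1 - int r)"
definition hi :: int where "hi = (if \<sigma> = 1 then int n - 1 - int r else int r)"
definition row :: "nat \<Rightarrow> int" where "row i = \<sigma> * (int i - int r)"
text \<open>This is the representative of \<open>j - c\<close> modulo \<open>n\<close> in
  \<open>{- L..M}\<close>; the shift by \<open>L\<close> moves the range of \<open>mod\<close>
  there.\<close>

definition col :: "nat \<Rightarrow> int" where "col j = (int j - int c + L) mod int n - L"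
definition coord :: "nat \<times> nat \<Rightarrow> int \<times> int" where "coord = map_prod row col"
definition level :: "nat \<times> nat \<Rightarrow> nat" where
  "level v = nat (\<bar>fst (coord v)\<bar> + \<bar>snd (coord v)\<bar>)"

abbreviation "V \<equiv> {..<n} \<times> {..<n}"
abbreviation "Z \<equiv> {- lo..hi} \<times> {- L..M}"
abbreviation "G \<equiv> with_proj (path_graph n \<box> cycle_graph n)"

lemma L_M: "L + M + 1 = int n" "M = L \<or> M = L + 1" "1 \<le> L"
  unfolding L_def M_def using n_ge by linarith+

lemma lo_hi: "lo + hi + 1 = int n" "0 \<le> lo" "0 \<le> hi"
  unfolding lo_def hi_def using r_less by auto

lemma col_range: "- L \<le> col j" "col j \<le> M"
proof -
  have "0 \<le> (int j - int c + L) mod int n" "(int j - int c + L) mod int n < int n"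
    using n_ge by auto
  then show "- L \<le> col j" "col j \<le> M" unfolding col_def using L_M(1) by linarith+
qed

lemma coord_root: "coord (r, c) = (0, 0)"
proof -
  have "L mod int n = L" using L_M by (intro mod_pos_pos_trivial) auto
  then show ?thesis by (simp add: coord_def row_def col_def)
qed

lemma bij_row: "bij_betw row {..<n} {- lo..hi}"
  by (rule bij_betw_byWitness[where f' = "\<lambda>t. nat (\<sigma> * t + int r)"])
    (use sign r_less in \<open>auto simp: row_def lo_def hi_def\<close>)

lemma bij_col: "bij_betw col {..<n} {- L..M}"
proof (rule bij_betw_byWitness[where f' = "\<lambda>b. nat ((b + int c) mod int n)"])
  show "\<forall>j \<in> {..<n}. nat ((col j + int c) mod int n) = j"
  proof
    fix j assume "j \<in> {..<n}"
    have "(col j + int c) mod int n = ((int j - int c + L) mod int n + (int c - L)) mod int n"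
      by (simp add: col_def algebra_simps)
    also have "\<dots> = int j mod int n" by (simp add: mod_simps)
    finally show "nat ((col j + int c) mod int n) = j" using \<open>j \<in> {..<n}\<close> by simp
  qed
  show "\<forall>b \<in> {- L..M}. col (nat ((b + int c) mod int n)) = b"
  proof
    fix b assume b: "b \<in> {- L..M}"
    have "int (nat ((b + int c) mod int n)) = (b + int c) mod int n" using n_ge by simp
    then have "col (nat ((b + int c) mod int n)) = ((b + int c) mod int n + (L - int c)) mod int n - L"
      by (simp add: col_def algebra_simps)
    also have "\<dots> = (b + L) mod int n - L" by (simp add: mod_simps)
    also have "(b + L) mod int n = b + L" using b L_M by auto
    finally show "col (nat ((b + int c) mod int n)) = b" by simp
  qed
qed (use col_range n_ge in \<open>auto simp: nat_less_iff\<close>)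

lemma bij_coord: "bij_betw coord V Z"
  unfolding coord_def by (intro bij_betw_map_prod bij_row bij_col)

lemma coord_in: "v \<in> V \<Longrightarrow> coord v \<in> Z"
  using bij_coord by (auto simp: bij_betw_def)

lemma coord_eq_iff: "u \<in> V \<Longrightarrow> v \<in> V \<Longrightarrow> coord u = coord v \<longleftrightarrow> u = v"
  using bij_coord by (auto simp: bij_betw_def inj_on_def)

lemma coord_surj:
  assumes "z \<in> Z"
  obtains u where "u \<in> V" "coord u = z"
  using assms bij_betw_imp_surj_on[OF bij_coord] by (metis imageE)

section \<open>Arcs and levels in coordinates\<close>

lemma row_adjacent: "(i' = Suc i \<or> i = Suc i') \<longleftrightarrow> \<bar>row i' - row i\<bar> = 1"
  using sign by (auto simp: row_def)

text \<open>Modulo \<open>n\<close> the claim says that \<open>n\<close> divides \<open>d\<close>.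
  Columns differ by less than \<open>n\<close>, so \<open>d\<close> is at least \<open>- n\<close>
  and less than \<open>n\<close>, which leaves \<open>0\<close> and \<open>- n\<close>; the latter
  is the step from the last column \<open>M\<close> to the first column \<open>- L\<close>.\<close>

lemma col_successor:
  assumes "j < n" "j' < n"
  shows "j' = Suc j mod n \<longleftrightarrow> col j' = col j + 1 \<or> col j = M \<and> col j' = - L"
proof -
  define d where "d = col j' - col j - 1"
  have "d mod int n = ((int j' - int c + L) mod int n - (int j - int c + L) mod int n - 1) mod int n"
    by (simp add: d_def col_def algebra_simps)
  also have "\<dots> = ((int j' - int c + L) - (int j - int c + L) - 1) mod int n"
    by (metis mod_diff_eq mod_diff_left_eq)
  also have "(int j' - int c + L) - (int j - int c + L) - 1 = int j' - (int j + 1)" by simp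
  finally have "int n dvd d \<longleftrightarrow> int j' mod int n = (int j + 1) mod int n"
    by (metis mod_eq_dvd_iff mod_eq_0_iff_dvd)
  moreover have "int j' mod int n = (int j + 1) mod int n \<longleftrightarrow> j' = Suc j mod n"
    using assms(2) by (metis mod_less of_nat_Suc of_nat_eq_iff of_nat_mod add.commute)
  moreover have "int n dvd d \<longleftrightarrow> d = 0 \<or> d = - int n"
  proof
    assume "int n dvd d"
    then obtain q where q: "d = int n * q" by (elim dvdE)
    have "- int n \<le> d" "d < int n"
      using col_range[of j] col_range[of j'] L_M(1) by (auto simp: d_def)
    then have "q < 1" "- 1 \<le> q"
      using q n_ge mult_le_cancel_left_pos[of "int n" "-1" q] mult_less_cancel_left_pos[of "int n" q 1]
      by auto
    then have "q = 0 \<or> q = - 1" by auto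
    then show "d = 0 \<or> d = - int n" using q by auto
  qed auto
  moreover have "d = - int n \<longleftrightarrow> col j = M \<and> col j' = - L"
    using col_range[of j] col_range[of j'] L_M(1) by (auto simp: d_def)
  moreover have "d = 0 \<longleftrightarrow> col j' = col j + 1" by (auto simp: d_def)
  ultimately show ?thesis by metis
qed

lemma arc_iff:
  assumes "u \<in> V" "v \<in> V"
  shows "(u, v) \<in> arcs_ends G \<longleftrightarrow> (case (coord u, coord v) of ((s, a), (t, b)) \<Rightarrow>
    b = a \<and> \<bar>t - s\<bar> = 1 \<or>
    t = s \<and> (\<bar>b - a\<bar> = 1 \<or> a = M \<and> b = - L \<or> b = M \<and> a = - L))"
proof -
  obtain i j i' j' where uv: "u = (i, j)" "v = (i', j')" by fastforce
  have *: "i < n" "j < n" "i' < n" "j' < n" using assms uv by auto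
  have eqs: "i = i' \<longleftrightarrow> row i' = row i" "j = j' \<longleftrightarrow> col j' = col j"
    using * bij_row bij_col by (auto simp: bij_betw_def inj_on_def)
  have "(u, v) \<in> arcs_ends G \<longleftrightarrow>
      ((i' = Suc i \<or> i = Suc i') \<and> j = j') \<or> (i = i' \<and> (j' = Suc j mod n \<or> j = Suc j' mod n))"
    using * by (auto simp: uv cartesian_product_def path_graph_def cycle_graph_def)
  also have "\<dots> \<longleftrightarrow> (\<bar>row i' - row i\<bar> = 1 \<and> col j' = col j) \<or>
      (row i' = row i \<and> ((col j' = col j + 1 \<or> col j = M \<and> col j' = - L) \<or>
        (col j = col j' + 1 \<or> col j' = M \<and> col j = - L)))"
    by (simp only: row_adjacent col_successor[OF *(2,4)] col_successor[OF *(4,2)] eqs)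
  also have "\<dots> \<longleftrightarrow> (case (coord u, coord v) of ((s, a), (t, b)) \<Rightarrow>
      b = a \<and> \<bar>t - s\<bar> = 1 \<or>
      t = s \<and> (\<bar>b - a\<bar> = 1 \<or> a = M \<and> b = - L \<or> b = M \<and> a = - L))"
    unfolding uv coord_def map_prod_simp prod.case by arith
  finally show ?thesis .
qed

text \<open>Of the arcs, those that raise the sum of the absolute coordinates remain. The arc
  between the columns \<open>- L\<close> and \<open>M\<close> is one of them only for
  \<open>M = L + 1\<close>; for \<open>M = L\<close> it joins vertices of equal level.\<close>

lemma child_iff:
  assumes "u \<in> V" "v \<in> V"
  shows "child L M (coord u) (coord v) \<longleftrightarrow> (u, v) \<in> arcs_ends G \<and> level v = Suc (level u)"
proof -
  obtain s a t b where uv: "coord u = (s, a)" "coord v = (t, b)" by fastforce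
  have "- L \<le> a" "a \<le> M" "- L \<le> b" "b \<le> M"
    using coord_in[OF assms(1)] coord_in[OF assms(2)] uv by auto
  moreover have "level v = Suc (level u) \<longleftrightarrow> \<bar>t\<bar> + \<bar>b\<bar> = \<bar>s\<bar> + \<bar>a\<bar> + 1"
  proof -
    have "int (level v) = \<bar>t\<bar> + \<bar>b\<bar>" "int (level u) = \<bar>s\<bar> + \<bar>a\<bar>"
      by (simp_all add: level_def uv)
    then show ?thesis by linarith
  qed
  ultimately show ?thesis
    unfolding arc_iff[OF assms] uv child_def prod.case using L_M(2,3) by smt
qed

lemma pverts_G [simp]: "pverts (path_graph n \<box> cycle_graph n) = V"
  by (auto simp: cartesian_product_def path_graph_def cycle_graph_def)

lemma verts_G: "verts G = V"
  by simp

lemma ex_child: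
  assumes "z \<in> Z" "z \<noteq> (0, 0)"
  shows "\<exists>u \<in> Z. child L M u z"
proof -
  obtain t b where z: "z = (t, b)" by fastforce
  define u where "u = (if t > 0 then (t - 1, b) else if t < 0 then (t + 1, b)
    else if b > 0 then (t, b - 1) else (t, b + 1))"
  have "u \<in> Z" "child L M u z" using assms L_M lo_hi by (auto simp: u_def z child_def)
  then show ?thesis by blast
qed

sublocale level_function G "(r, c)" level
proof
  show "(r, c) \<in> verts G" using r_less c_less by (simp add: verts_G)
  show "level (r, c) = 0" by (simp add: level_def coord_root)
  show "level v \<le> Suc (level u)" if "(u, v) \<in> arcs_ends G" for u v
  proof -
    have uv: "u \<in> V" "v \<in> V"
      using that by (auto simp: cartesian_product_def path_graph_def cycle_graph_def)
    obtain s a t b where c: "coord u = (s, a)" "coord v = (t, b)" by fastforce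
    show ?thesis
      using that coord_in[OF uv(1)] coord_in[OF uv(2)] L_M
      unfolding arc_iff[OF uv] by (auto simp: c level_def)
  qed
  show "\<exists>u \<in> verts G. (u, v) \<in> arcs_ends G \<and> level v = Suc (level u)"
    if v: "v \<in> verts G" "v \<noteq> (r, c)" for v
  proof -
    have "v \<in> V" using v(1) by (simp only: verts_G)
    moreover have "coord v \<noteq> (0, 0)"
      using coord_eq_iff[of v "(r, c)"] v \<open>v \<in> V\<close> coord_root r_less c_less by auto
    ultimately obtain z where z: "z \<in> Z" "child L M z (coord v)"
      using ex_child coord_in by blast
    then obtain u where "u \<in> V" "coord u = z" by (elim coord_surj)
    then show ?thesis using child_iff[of u v] z(2) \<open>v \<in> V\<close> unfolding verts_G by blast
  qed
qed

section \<open>Transfer of both criteria to coordinates\<close>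

lemma parent_iff: "u \<in> V \<Longrightarrow> v \<in> V \<Longrightarrow> parent u v \<longleftrightarrow> child L M (coord u) (coord v)"
  using child_iff verts_G by (simp add: parent_def)

lemma visibility_set_charging_coord:
  assumes "visibility_set G (r, c) S"
  shows "\<exists>f T. T \<subseteq> Z \<and> card T = card S \<and> (\<forall>z \<in> Z - {(0, 0)}. f z \<in> Z - T \<and>
    (\<forall>w \<in> Z - {(0, 0)}. f z = f w \<longrightarrow> z \<noteq> w \<longrightarrow> child L M (f z) z))"
proof -
  define ve where "ve = inv_into V coord"
  have ve: "ve z \<in> V" "coord (ve z) = z" if "z \<in> Z" for z
    using that bij_coord by (auto simp: ve_def bij_betw_def inv_into_into f_inv_into_f)
  have S: "S \<subseteq> V" using assms by (auto simp: visibility_set_iff verts_G)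
  obtain f where f: "\<forall>v \<in> verts G - {(r, c)}. f v \<in> verts G - S \<and>
      (\<forall>w \<in> verts G - {(r, c)}. f v = f w \<longrightarrow> v \<noteq> w \<longrightarrow> parent (f v) v)"
    using visibility_set_charging[OF assms] by (elim exE)
  have f1: "f v \<in> V - S" if "v \<in> V - {(r, c)}" for v
    using f that unfolding verts_G by blast
  have f2: "parent (f v) v"
    if "v \<in> V - {(r, c)}" "w \<in> V - {(r, c)}" "f v = f w" "v \<noteq> w" for v w
    using f that unfolding verts_G by metis
  define g where "g z = coord (f (ve z))" for z
  have ve': "ve z \<in> V - {(r, c)}" if "z \<in> Z - {(0, 0)}" for z
    using ve[of z] that coord_root by (metis DiffE DiffI singletonD singletonI)
  have "g z \<in> Z - coord ` S" if "z \<in> Z - {(0, 0)}" for z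
    using f1[OF ve'[OF that]] coord_in[of "f (ve z)"] coord_eq_iff S
    by (auto simp: g_def image_iff)
  moreover have "child L M (g z) z"
    if "z \<in> Z - {(0, 0)}" "w \<in> Z - {(0, 0)}" "g z = g w" "z \<noteq> w" for z w
  proof -
    have "f (ve z) = f (ve w)"
      using that(3) coord_eq_iff f1[OF ve'[OF that(1)]] f1[OF ve'[OF that(2)]]
      by (simp add: g_def)
    moreover have "ve z \<noteq> ve w" using ve[of z] ve[of w] that by auto
    ultimately have "parent (f (ve z)) (ve z)" using f2 ve' that by metis
    then show ?thesis
      using parent_iff[of "f (ve z)" "ve z"] f1[OF ve'[OF that(1)]] ve[of z] that(1)
      by (simp add: g_def)
  qed
  moreover have "coord ` S \<subseteq> Z" using S coord_in by blast
  moreover have "card (coord ` S) = card S"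
    using S bij_coord by (intro card_image) (metis bij_betw_def inj_on_subset)
  ultimately show ?thesis by (intro exI[of _ g] exI[of _ "coord ` S"]) simp
qed

lemma visibility_set_if_children_cover:
  assumes "R \<subseteq> Z" "(0, 0) \<in> R"
    and "\<And>z. z \<in> Z \<Longrightarrow> z \<noteq> (0, 0) \<Longrightarrow> \<exists>u \<in> R. child L M u z"
  shows "\<exists>S. visibility_set G (r, c) S \<and> card S + card R = n * n"
proof -
  define S where "S = {v \<in> V. coord v \<notin> R}"
  have rc: "(r, c) \<in> V" using r_less c_less by auto
  have "visibility_set G (r, c) S"
  proof (rule visibility_set_if_parent_notin)
    show "S \<subseteq> verts G - {(r, c)}" using assms(2) coord_root by (auto simp: S_def verts_G)
    fix v assume "v \<in> verts G" "v \<noteq> (r, c)"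
    then have v: "v \<in> V" "coord v \<noteq> (0, 0)"
      using coord_eq_iff[of v "(r, c)"] rc coord_root by (auto simp: verts_G)
    then obtain z where z: "z \<in> R" "child L M z (coord v)" using assms(3) coord_in by blast
    then obtain u where u: "u \<in> V" "coord u = z"
      using assms(1) coord_surj[of z] by blast
    then show "\<exists>u. parent u v \<and> u \<notin> S"
      using z parent_iff[of u v] v by (auto simp: S_def)
  qed
  moreover have "card S + card R = n * n"
  proof -
    have "card (V - S) = card R"
    proof (rule bij_betw_same_card)
      have "coord ` (V - S) = R"
      proof
        show "coord ` (V - S) \<subseteq> R" by (auto simp: S_def)
        show "R \<subseteq> coord ` (V - S)"
        proof
          fix z assume "z \<in> R"
          then obtain u where "u \<in> V" "coord u = z" using assms(1) coord_surj[of z] by blast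
          then show "z \<in> coord ` (V - S)" using \<open>z \<in> R\<close> by (auto simp: S_def)
        qed
      qed
      moreover have "inj_on coord (V - S)"
        using bij_coord by (metis bij_betw_def Diff_subset inj_on_subset)
      ultimately show "bij_betw coord (V - S) R" by (simp add: bij_betw_def)
    qed
    moreover have "card (V - S) + card S = card V"
    proof -
      have "S \<subseteq> V" by (auto simp: S_def)
      then show ?thesis by (metis card_Diff_subset card_mono finite_SigmaI finite_lessThan
          finite_subset le_add_diff_inverse2)
    qed
    ultimately show ?thesis by simp
  qed
  ultimately show ?thesis by blast
qed

end

section \<open>Packings and blocks\<close>

lemma card_le_2I:
  assumes "\<And>a b c. a \<in> A \<Longrightarrow> b \<in> A \<Longrightarrow> c \<in> A \<Longrightarrow> a = b \<or> a = c \<or> b = c"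
  shows "card A \<le> 2"
proof (rule ccontr)
  assume "\<not> card A \<le> 2"
  then obtain B where "B \<subseteq> A" "card B = 3"
    using obtain_subset_with_card_n[of 3 A] by auto
  then show False using assms by (fastforce simp: card_3_iff)
qed

lemma half_card_le_card_image:
  assumes "finite A" and "\<And>y. card {a \<in> A. f a = y} \<le> 2"
  shows "(card A + 1) div 2 \<le> card (f ` A)"
proof -
  have "card A = card (\<Union>y \<in> f ` A. {a \<in> A. f a = y})"
    by (rule arg_cong[of _ _ card]) auto
  also have "\<dots> \<le> (\<Sum>y \<in> f ` A. card {a \<in> A. f a = y})"
    using assms(1) by (intro card_UN_le) auto
  also have "\<dots> \<le> (\<Sum>y \<in> f ` A. 2)" by (intro sum_mono assms)
  finally show ?thesis by simp
qed

text \<open>A collision turns the common value of \<open>f\<close> into a common parent. Hence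
  \<open>f\<close> is injective on \<open>W\<close>, at most two-to-one on \<open>C\<close> and on
  \<open>D\<close>, and the three images are disjoint; all of them lie in
  \<open>Z - T\<close>.\<close>

lemma charging_bound:
  fixes f :: "'a \<Rightarrow> 'a" and P :: "'a \<Rightarrow> 'a \<Rightarrow> bool"
  assumes "finite Z" "T \<subseteq> Z" and U: "W \<union> C \<union> D \<subseteq> U" "U \<subseteq> Z"
    and f: "\<And>z. z \<in> U \<Longrightarrow> f z \<in> Z - T"
    and collision: "\<And>z w. z \<in> U \<Longrightarrow> w \<in> U \<Longrightarrow> f z = f w \<Longrightarrow> z \<noteq> w \<Longrightarrow> P (f z) z"
    and disjoint: "W \<inter> C = {}" "W \<inter> D = {}" "C \<inter> D = {}"
    and packing: "\<And>u z w. u \<in> Z \<Longrightarrow> P u z \<Longrightarrow> P u w \<Longrightarrow> z \<in> W \<Longrightarrow> w \<in> W \<Longrightarrow> z = w"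
    and block1: "\<And>u x y z. u \<in> Z \<Longrightarrow> P u x \<Longrightarrow> P u y \<Longrightarrow> P u z \<Longrightarrow> x \<in> C \<Longrightarrow> y \<in> C \<Longrightarrow> z \<in> C
        \<Longrightarrow> x = y \<or> x = z \<or> y = z"
    and block2: "\<And>u x y z. u \<in> Z \<Longrightarrow> P u x \<Longrightarrow> P u y \<Longrightarrow> P u z \<Longrightarrow> x \<in> D \<Longrightarrow> y \<in> D \<Longrightarrow> z \<in> D
        \<Longrightarrow> x = y \<or> x = z \<or> y = z"
    and separated: "\<And>u z w. u \<in> Z \<Longrightarrow> P u z \<Longrightarrow> P u w \<Longrightarrow> z \<in> W \<Longrightarrow> w \<notin> C \<union> D"
      "\<And>u z w. u \<in> Z \<Longrightarrow> P u z \<Longrightarrow> P u w \<Longrightarrow> z \<in> C \<Longrightarrow> w \<notin> D"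
  shows "card T + card W + (card C + 1) div 2 + (card D + 1) div 2 \<le> card Z"
proof -
  have fin: "finite W" "finite C" "finite D" "finite T"
    using assms(1,2) U by (meson finite_subset le_sup_iff)+
  have both: "f z \<in> Z \<and> P (f z) z \<and> P (f z) w"
    if "z \<in> U" "w \<in> U" "f z = f w" "z \<noteq> w" for z w
    using f[OF that(1)] collision[OF that] collision[OF that(2,1) that(3,4)[symmetric]] that(3)
    by (metis DiffD1)
  have "inj_on f W"
  proof (rule inj_onI, rule ccontr)
    fix z w assume zw: "z \<in> W" "w \<in> W" "f z = f w" "z \<noteq> w"
    then have "z \<in> U" "w \<in> U" using U by auto
    then show False using both[OF _ _ zw(3,4)] packing[of "f z" z w] zw by metis
  qed
  then have "card (f ` W) = card W" by (rule card_image)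
  moreover have fibre: "card {a \<in> B. f a = y} \<le> 2"
    if "B \<subseteq> U" and block: "\<And>u x y z. u \<in> Z \<Longrightarrow> P u x \<Longrightarrow> P u y \<Longrightarrow> P u z
      \<Longrightarrow> x \<in> B \<Longrightarrow> y \<in> B \<Longrightarrow> z \<in> B \<Longrightarrow> x = y \<or> x = z \<or> y = z" for B y
  proof (rule card_le_2I, rule ccontr)
    fix a b c
    assume "a \<in> {a \<in> B. f a = y}" "b \<in> {a \<in> B. f a = y}" "c \<in> {a \<in> B. f a = y}"
      and ne: "\<not> (a = b \<or> a = c \<or> b = c)"
    then have abc: "a \<in> B" "b \<in> B" "c \<in> B" "f a = y" "f b = y" "f c = y" by auto
    then have "y \<in> Z" "P y a" "P y b" "P y c"
      using both[of a b] both[of a c] that(1) ne by (auto simp: subset_iff)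
    then show False using block[of y a b c] abc ne by metis
  qed
  have "card {a \<in> C. f a = y} \<le> 2" for y
    using U by (intro fibre block1) auto
  then have "(card C + 1) div 2 \<le> card (f ` C)" by (rule half_card_le_card_image[OF fin(2)])
  moreover have "card {a \<in> D. f a = y} \<le> 2" for y
    using U by (intro fibre block2) auto
  then have "(card D + 1) div 2 \<le> card (f ` D)" by (rule half_card_le_card_image[OF fin(3)])
  moreover have "f z \<noteq> f w" if "z \<in> W \<and> w \<in> C \<union> D \<or> z \<in> C \<and> w \<in> D" for z w
  proof
    assume "f z = f w"
    moreover have "z \<in> U" "w \<in> U" "z \<noteq> w" using that U disjoint by auto
    ultimately have "f z \<in> Z" "P (f z) z" "P (f z) w" using both[of z w] by metis+
    then show False using separated[of "f z" z w] that by blast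
  qed
  then have "f ` W \<inter> f ` C = {}" "(f ` W \<union> f ` C) \<inter> f ` D = {}" by blast+
  then have "card (f ` W \<union> f ` C \<union> f ` D) = card (f ` W) + card (f ` C) + card (f ` D)"
    using fin by (simp add: card_Un_disjoint)
  moreover have "card (f ` W \<union> f ` C \<union> f ` D) \<le> card (Z - T)"
    using assms(1) f U by (intro card_mono) auto
  moreover have "card (Z - T) = card Z - card T" "card T \<le> card Z"
    using assms(1,2) fin by (auto simp: card_Diff_subset card_mono)
  ultimately show ?thesis by linarith
qed

section \<open>Counting columns\<close>

lemma card_even_le:
  fixes L M x :: int
  assumes "0 \<le> x" "x \<le> L" "L \<le> M"
  shows "int (card {b \<in> {- L..M}. \<bar>b\<bar> \<le> x \<and> even b}) = 2 * (x div 2) + 1"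
proof -
  have "{b \<in> {- L..M}. \<bar>b\<bar> \<le> x \<and> even b} = (*) 2 ` {- (x div 2)..x div 2}"
    using assms by (auto simp: image_iff elim!: evenE)
  moreover have "inj_on ((*) (2 :: int)) {- (x div 2)..x div 2}" by (simp add: inj_on_def)
  ultimately show ?thesis using assms by (simp add: card_image)
qed

text \<open>The bound \<open>x\<close> excludes no column here. For odd \<open>M\<close> the even
  columns are those up to \<open>M - 1\<close> in absolute value; for even \<open>M = L + 1\<close>
  there is also the column \<open>M\<close>, which has no mirror image.\<close>

lemma card_even_ge:
  fixes L M x :: int
  assumes "M \<le> x" "1 \<le> L" "M = L + 1 \<or> M = L \<and> odd M"
  shows "int (card {b \<in> {- L..M}. \<bar>b\<bar> \<le> x \<and> even b}) = M"
proof (cases "even M")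
  case False
  have "{b \<in> {- L..M}. \<bar>b\<bar> \<le> x \<and> even b} = {b \<in> {- L..M}. \<bar>b\<bar> \<le> M - 1 \<and> even b}"
  proof -
    have "(\<bar>b\<bar> \<le> x \<and> even b) = (\<bar>b\<bar> \<le> M - 1 \<and> even b)" if b: "b \<in> {- L..M}" for b
    proof (cases "even b")
      case True
      then have "\<bar>b\<bar> \<noteq> M" using False by (metis dvd_abs_iff)
      moreover have "\<bar>b\<bar> \<le> M" using assms b by auto
      ultimately have "\<bar>b\<bar> \<le> M - 1" by linarith
      then show ?thesis using assms True by auto
    qed simp
    then show ?thesis by blast
  qed
  moreover have "int (card {b \<in> {- L..M}. \<bar>b\<bar> \<le> M - 1 \<and> even b}) = 2 * ((M - 1) div 2) + 1"
    using assms by (intro card_even_le) auto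
  moreover have "2 * ((M - 1) div 2) = M - 1" using False by presburger
  ultimately show ?thesis by simp
next
  case True
  define E where "E = {b \<in> {- L..M}. \<bar>b\<bar> \<le> M - 1 \<and> even b}"
  have "{b \<in> {- L..M}. \<bar>b\<bar> \<le> x \<and> even b} = insert M E"
    using assms True by (auto simp: E_def)
  moreover have "finite E" by (rule finite_subset[of _ "{- L..M}"]) (auto simp: E_def)
  moreover have "M \<notin> E" using assms by (auto simp: E_def)
  moreover have "int (card E) = 2 * ((M - 1) div 2) + 1"
    unfolding E_def using assms by (intro card_even_le) auto
  moreover have "2 * ((M - 1) div 2) = M - 2" using True by presburger
  ultimately show ?thesis by simp
qed

lemma card_far:
  fixes L M x :: int
  assumes "1 \<le> x" "x \<le> L + 1" "L \<le> M"
  shows "int (card {b \<in> {- L..M}. x \<le> \<bar>b\<bar>}) = L + M + 2 - 2 * x"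
proof -
  have "{b \<in> {- L..M}. x \<le> \<bar>b\<bar>} = {- L..M} - {- (x - 1)..x - 1}" using assms by auto
  moreover have "card ({- L..M} - {- (x - 1)..x - 1}) = card {- L..M} - card {- (x - 1)..x - 1}"
    using assms by (intro card_Diff_subset) auto
  ultimately show ?thesis using assms by simp
qed

lemma card_far_ge:
  fixes L M x :: int
  assumes "1 \<le> x" "L \<le> M" "M \<le> L + 1"
  shows "L + M + 2 - 2 * x \<le> int (card {b \<in> {- L..M}. x \<le> \<bar>b\<bar>})"
proof (cases "x \<le> L + 1")
  case True
  then show ?thesis using card_far[of x L M] assms by simp
next
  case False
  then have "L + M + 2 - 2 * x \<le> 0" using assms by linarith
  then show ?thesis by linarith
qed

text \<open>The counts of single rows below vary with the parity of the row, while two consecutive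
  rows together have a constant bound. Rows are therefore summed in pairs.\<close>

lemma sum_pairs_ge:
  fixes F :: "nat \<Rightarrow> int"
  assumes "\<And>l. l < q \<Longrightarrow> p \<le> F (2 * l) + F (2 * l + 1)"
  shows "int q * p \<le> (\<Sum>i < 2 * q. F i)"
  using assms
proof (induction q)
  case (Suc q)
  have "int q * p \<le> (\<Sum>i < 2 * q. F i)" using Suc by auto
  then show ?case using Suc.prems[of q] by (simp add: algebra_simps)
qed auto

lemma sum_pairs_le:
  fixes F :: "nat \<Rightarrow> int"
  assumes "\<And>l. l < q \<Longrightarrow> F (2 * l) + F (2 * l + 1) \<le> p"
  shows "(\<Sum>i < 2 * q. F i) \<le> int q * p"
proof -
  have "int q * - p \<le> (\<Sum>i < 2 * q. - F i)"
    using assms by (intro sum_pairs_ge) (simp add: algebra_simps)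
  then show ?thesis by (simp add: sum_negf)
qed

section \<open>The upper bound in coordinates\<close>

locale box =
  fixes L M lo hi :: int
  assumes L_M: "M = L \<or> M = L + 1" "1 \<le> L" "3 \<le> L + M"
    and lo_hi: "0 \<le> lo" "lo \<le> hi" "lo + hi = L + M"
begin

abbreviation "Z \<equiv> {- lo..hi} \<times> {- L..M}"

lemma lo_le: "lo \<le> L" and hi_ge: "M \<le> hi"
  using L_M lo_hi by linarith+

lemma finite_sub_Z: "A \<subseteq> Z \<Longrightarrow> finite A"
  by (rule finite_subset) auto

lemma card_Z: "int (card Z) = (L + M + 1) * (L + M + 1)"
proof -
  have "int (card {- lo..hi}) = L + M + 1" "int (card {- L..M}) = L + M + 1"
    using L_M lo_hi by simp_all
  then show ?thesis by (simp only: card_cartesian_product of_nat_mult)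
qed

text \<open>A row step and a column step from \<open>u\<close> lead to adjacent rows and to columns
  at distance 1, or \<open>2 * L + 1\<close> for the wrap-around, which is odd. Within
  \<open>Z\<close>, two column steps are possible only from column 0 and two row steps only from row
  0; these give the mirror images.\<close>

lemma siblings:
  assumes "child L M u (t, b)" "child L M u (t', b')" "(t, b) \<noteq> (t', b')"
    and "(t, b) \<in> Z" "(t', b') \<in> Z" "u \<in> Z"
  shows "\<bar>t\<bar> + \<bar>b\<bar> = \<bar>t'\<bar> + \<bar>b'\<bar>"
    and "\<bar>t - t'\<bar> = 1 \<and> odd (b - b') \<or> t = t' \<and> \<bar>b\<bar> = 1 \<and> b' = - b \<or> b = b' \<and> \<bar>t\<bar> = 1 \<and> t' = - t"
proof -
  obtain s c where u: "u = (s, c)" by fastforce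
  have *: "- L \<le> c" "c \<le> M" "- L \<le> b" "b \<le> M" "- L \<le> b'" "b' \<le> M" using assms u by auto
  have 1: "(b = c \<and> (0 \<le> s \<and> t = s + 1 \<or> s \<le> 0 \<and> t = s - 1)) \<or>
      (t = s \<and> (0 \<le> c \<and> b = c + 1 \<or> c \<le> 0 \<and> b = c - 1 \<or> c = - L \<and> b = M \<and> M = L + 1))"
    using assms(1) by (simp add: u child_def)
  have 2: "(b' = c \<and> (0 \<le> s \<and> t' = s + 1 \<or> s \<le> 0 \<and> t' = s - 1)) \<or>
      (t' = s \<and> (0 \<le> c \<and> b' = c + 1 \<or> c \<le> 0 \<and> b' = c - 1 \<or> c = - L \<and> b' = M \<and> M = L + 1))"
    using assms(2) by (simp add: u child_def)
  show "\<bar>t\<bar> + \<bar>b\<bar> = \<bar>t'\<bar> + \<bar>b'\<bar>" using 1 2 * L_M by smt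
  have ne: "t \<noteq> t' \<or> b \<noteq> b'" using assms(3) by auto
  have "\<bar>t - t'\<bar> = 1 \<and> (\<bar>b - b'\<bar> = 1 \<or> \<bar>b - b'\<bar> = 2 * L + 1) \<or>
      t = t' \<and> \<bar>b\<bar> = 1 \<and> b' = - b \<or> b = b' \<and> \<bar>t\<bar> = 1 \<and> t' = - t"
    using 1 2 * L_M ne by smt
  moreover have "odd (b - b')" if "\<bar>b - b'\<bar> = 1 \<or> \<bar>b - b'\<bar> = 2 * L + 1"
    using that by presburger
  ultimately show "\<bar>t - t'\<bar> = 1 \<and> odd (b - b') \<or> t = t' \<and> \<bar>b\<bar> = 1 \<and> b' = - b \<or> b = b' \<and> \<bar>t\<bar> = 1 \<and> t' = - t"
    by metis
qed

text \<open>This is the case \<open>n\<close> \<equiv> 1 modulo 4. The packing consists of the even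
  columns without the row \<open>- 1\<close> and the root, and both blocks are empty. Of the three
  cases in \<open>siblings\<close>, the even columns exclude the first two and the missing row the
  third.\<close>

lemma columns_bound:
  assumes "even L" "M = L" and T: "T \<subseteq> Z"
    and f: "\<And>z. z \<in> Z - {(0, 0)} \<Longrightarrow> f z \<in> Z - T"
    and collision: "\<And>z w. z \<in> Z - {(0, 0)} \<Longrightarrow> w \<in> Z - {(0, 0)} \<Longrightarrow>
      f z = f w \<Longrightarrow> z \<noteq> w \<Longrightarrow> child L M (f z) z"
  shows "int (card T) + 2 * L * (L + 1) - 1 \<le> (L + M + 1) * (L + M + 1)"
proof -
  define W where "W = ({- lo..hi} - {- 1}) \<times> {b \<in> {- L..M}. \<bar>b\<bar> \<le> L \<and> even b} - {(0, 0)}"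
  have sub: "W \<subseteq> Z - {(0, 0)}" by (auto simp: W_def)
  have "card T + card W + (card ({} :: (int \<times> int) set) + 1) div 2
      + (card ({} :: (int \<times> int) set) + 1) div 2 \<le> card Z"
  proof (rule charging_bound[where U = "Z - {(0, 0)}" and f = f and P = "child L M"])
    show "z = w" if "u \<in> Z" "child L M u z" "child L M u w" "z \<in> W" "w \<in> W" for u z w
    proof (rule ccontr)
      assume ne: "z \<noteq> w"
      obtain t b t' b' where zw: "z = (t, b)" "w = (t', b')" by fastforce
      have "even b" "even b'" "t \<noteq> - 1" "t' \<noteq> - 1" using that zw by (auto simp: W_def)
      moreover have "z \<in> Z" "w \<in> Z" using that sub by auto
      then have "\<bar>t - t'\<bar> = 1 \<and> odd (b - b') \<or> t = t' \<and> \<bar>b\<bar> = 1 \<and> b' = - b \<or>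
          b = b' \<and> \<bar>t\<bar> = 1 \<and> t' = - t"
        using that(1-3) ne unfolding zw by (intro siblings(2))
      ultimately show False by presburger
    qed
  qed (use f collision T sub in auto)
  then have "card T + card W \<le> card Z" by linarith
  then have bound: "int (card T) + int (card W) \<le> (L + M + 1) * (L + M + 1)"
    using card_Z by linarith
  have "int (card {b \<in> {- L..M}. \<bar>b\<bar> \<le> L \<and> even b}) = L + 1"
    using card_even_le[of L L M] assms L_M by auto
  moreover have "int (card ({- lo..hi} - {- 1})) \<ge> 2 * L"
  proof -
    have "int (card {- lo..hi}) = 2 * L + 1" using lo_hi assms by simp
    moreover have "card {- lo..hi} - 1 \<le> card ({- lo..hi} - {- 1})"
      by (rule order_trans[OF _ diff_card_le_card_Diff]) simp_all
    ultimately show ?thesis by linarith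
  qed
  ultimately have "int (card (({- lo..hi} - {- 1}) \<times> {b \<in> {- L..M}. \<bar>b\<bar> \<le> L \<and> even b})) \<ge> 2 * L * (L + 1)"
    using L_M by (simp add: card_cartesian_product mult_right_mono)
  moreover have "card (({- lo..hi} - {- 1}) \<times> {b \<in> {- L..M}. \<bar>b\<bar> \<le> L \<and> even b}) - 1 \<le> card W"
    unfolding W_def by (rule order_trans[OF _ diff_card_le_card_Diff]) simp_all
  ultimately show ?thesis using bound by linarith
qed

text \<open>
  The packing for \<open>n\<close> not congruent to 1 modulo 4. Alternate columns are optimal on most levels, but
  beyond the level \<open>hi\<close> (in the lower half: \<open>M + 1\<close>) the level sets are unions of paths, where
  alternate vertices including both ends are better; this gives alternate rows. On the level
  \<open>hi + 1\<close> the vertices \<open>(hi, 1)\<close> and \<open>(hi, - 1)\<close> share a parent, which for even \<open>n\<close> closes the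
  level up to an odd cycle, so that it is treated as a block. The row \<open>- 1\<close> shares parents with the
  rows 0 and 1; single vertices of it are needed only if it is the last row, i.e. \<open>lo = 1\<close>.
\<close>

definition top_part :: "(int \<times> int) set" where
  "top_part = {(t, b) \<in> Z. 0 \<le> t \<and> (t, b) \<noteq> (0, 0) \<and>
    (t + \<bar>b\<bar> \<le> hi \<and> even b \<or> hi + 2 \<le> t + \<bar>b\<bar> \<and> even (hi - t))}"

definition top_block :: "(int \<times> int) set" where
  "top_block = {(t, b) \<in> Z. 0 \<le> t \<and> t + \<bar>b\<bar> = hi + 1}"

definition bottom_part :: "(int \<times> int) set" where
  "bottom_part = {(t, b) \<in> Z. t \<le> - 2 \<and>
    (if even lo then even t \<and> b \<noteq> - 1
     else \<bar>b\<bar> - t \<le> M + 1 \<and> even b \<or> M + 2 \<le> \<bar>b\<bar> - t \<and> odd t)}"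

text \<open>Here \<open>n\<close> is divisible by 4 and \<open>(0, M)\<close> shares parents with
  \<open>(- 1, L)\<close> and \<open>(- 1, - L)\<close>, with the second by wrap-around. It leaves
  the packing and forms a block with them, which counts 2 instead of 1.\<close>

definition swapped :: bool where
  "swapped \<longleftrightarrow> lo = 1 \<and> M = L + 1 \<and> even M"

text \<open>A vertex \<open>(- 1, b)\<close> of this set shares a parent only with
  \<open>(1, b)\<close>, which lies in an odd column on a level at most \<open>hi\<close> and hence
  not in \<open>top_part\<close>. For \<open>M = L + 1\<close> there is no column
  \<open>- M\<close>.\<close>

definition extra_part :: "(int \<times> int) set" where
  "extra_part = {(t, b). lo = 1 \<and> t = - 1 \<and> odd M \<and> (b = M \<or> M = L \<and> b = - M)}"

definition packing :: "(int \<times> int) set" where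
  "packing = (if swapped then top_part - {(0, M)} else top_part) \<union> bottom_part \<union> extra_part"

text \<open>
  For \<open>n = 4\<close> the vertices \<open>(- 1, L)\<close> and \<open>(- 1, - L)\<close> have the common parent \<open>(- 1, 0)\<close>, so the
  three vertices cannot be replaced by these two in the packing.
\<close>

definition extra_block :: "(int \<times> int) set" where
  "extra_block = (if swapped then {(0, M), (- 1, L), (- 1, - L)} else {})"

section \<open>Common parents within the packing and the blocks\<close>

lemma packing_cases:
  assumes "(t, b) \<in> packing"
  obtains "0 \<le> t" "t + \<bar>b\<bar> \<le> hi \<and> even b \<or> hi + 2 \<le> t + \<bar>b\<bar> \<and> even (hi - t)"
    | "t \<le> - 2" "if even lo then even t \<and> b \<noteq> - 1
        else \<bar>b\<bar> - t \<le> M + 1 \<and> even b \<or> M + 2 \<le> \<bar>b\<bar> - t \<and> odd t"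
    | "t = - 1" "lo = 1" "odd b" "odd M" "\<bar>b\<bar> = M"
proof -
  have "(t, b) \<in> top_part \<or> (t, b) \<in> bottom_part \<or> (t, b) \<in> extra_part"
    using assms by (auto simp: packing_def split: if_splits)
  then show thesis
  proof (elim disjE)
    assume "(t, b) \<in> extra_part"
    then show thesis using L_M that(3) by (auto simp: extra_part_def)
  qed (use that in \<open>simp_all add: top_part_def bottom_part_def\<close>)
qed

lemma packing_sub: "packing \<subseteq> Z - {(0, 0)}"
proof -
  have "top_part \<subseteq> Z - {(0, 0)}" "bottom_part \<subseteq> Z - {(0, 0)}"
    by (auto simp: top_part_def bottom_part_def)
  moreover have "extra_part \<subseteq> Z - {(0, 0)}"
    using L_M lo_hi by (auto simp: extra_part_def)
  ultimately show ?thesis by (auto simp: packing_def)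
qed

lemma top_block_sub: "top_block \<subseteq> Z - {(0, 0)}"
  using lo_hi by (auto simp: top_block_def)

lemma extra_block_sub: "extra_block \<subseteq> Z - {(0, 0)}"
  using L_M lo_hi by (auto simp: extra_block_def swapped_def)

text \<open>In the first case of \<open>siblings\<close>, the level is the same, and on each level
  the upper and the lower half use only even columns or only rows of one parity. In the second, the
  columns are 1 and \<open>- 1\<close>: for even \<open>lo\<close> the lower half omits
  \<open>- 1\<close>, and otherwise odd columns occur only on levels too high for these vertices. In
  the third, the row \<open>- 1\<close> contains only odd columns \<open>b\<close> with
  \<open>\<bar>b\<bar> = M\<close>, and these are absent from row 1.\<close>

lemma packing_no_siblings:
  assumes "u \<in> Z" "child L M u z" "child L M u w" "z \<in> packing" "w \<in> packing"
  shows "z = w"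
proof (rule ccontr)
  assume ne: "z \<noteq> w"
  obtain t b t' b' where zw: "z = (t, b)" "w = (t', b')" by fastforce
  have Z: "z \<in> Z" "w \<in> Z" using assms packing_sub by auto
  note sib = siblings[OF assms(2,3)[unfolded zw] ne[unfolded zw] Z[unfolded zw] assms(1)]
  have mem: "(0 \<le> t \<and> (t + \<bar>b\<bar> \<le> hi \<and> even b \<or> hi + 2 \<le> t + \<bar>b\<bar> \<and> even (hi - t))) \<or>
      (t \<le> - 2 \<and> (if even lo then even t \<and> b \<noteq> - 1
         else \<bar>b\<bar> - t \<le> M + 1 \<and> even b \<or> M + 2 \<le> \<bar>b\<bar> - t \<and> odd t)) \<or>
      (lo = 1 \<and> t = - 1 \<and> odd b \<and> \<bar>b\<bar> = M)"
    if "(t, b) \<in> packing" for t b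
    using that by (rule packing_cases) simp_all
  note mem' = mem[OF assms(4)[unfolded zw]] mem[OF assms(5)[unfolded zw]]
  have range: "- lo \<le> t" "- lo \<le> t'" "t \<le> hi" "t' \<le> hi" "- L \<le> b" "- L \<le> b'" "b \<le> M" "b' \<le> M"
    using Z zw by auto
  have parity: "even (hi - t) \<longleftrightarrow> (even hi \<longleftrightarrow> even t)" "even (hi - t') \<longleftrightarrow> (even hi \<longleftrightarrow> even t')"
    by simp_all
  from sib(2) consider "\<bar>t - t'\<bar> = 1" "odd (b - b')" | "t = t'" "\<bar>b\<bar> = 1" "b' = - b"
    | "b = b'" "\<bar>t\<bar> = 1" "t' = - t" by metis
  then show False
  proof cases
    case 1
    then have "even b \<longleftrightarrow> odd b'" "even t \<longleftrightarrow> odd t'" by presburger+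
    then show False using 1(1) mem' parity range sib(1) L_M lo_hi lo_le hi_ge by smt
  next
    case 2
    have False if "(t, 1) \<in> packing" "(t, - 1) \<in> packing"
    proof -
      have "M \<noteq> 1" using L_M by linarith
      then show False using mem[OF that(1)] mem[OF that(2)] range(1,3) lo_le L_M by (auto split: if_splits)
    qed
    moreover have "b = 1 \<and> b' = - 1 \<or> b = - 1 \<and> b' = 1" using 2 by linarith
    ultimately show False using assms(4,5) 2(1) unfolding zw by metis
  next
    case 3
    have False if "(1, b) \<in> packing" "(- 1, b) \<in> packing"
    proof -
      have "odd b" "\<bar>b\<bar> = M" using mem[OF that(2)] by simp_all
      then show False using mem[OF that(1)] hi_ge by simp
    qed
    moreover have "t = 1 \<and> t' = - 1 \<or> t = - 1 \<and> t' = 1" using 3 by linarith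
    ultimately show False using assms(4,5) 3(1) unfolding zw by metis
  qed
qed

text \<open>From a parent \<open>(s, c)\<close> with \<open>c \<noteq> 0\<close> there are one row
  step upwards and at most one column step, as the wrap-around replaces a step out of range. From
  \<open>(s, 0)\<close> there are two column steps, but a row step to level \<open>hi + 1\<close>
  would leave the last row.\<close>

lemma top_block_no_three_siblings:
  assumes "u \<in> Z" "child L M u x" "child L M u y" "child L M u z"
    and "x \<in> top_block" "y \<in> top_block" "z \<in> top_block"
  shows "x = y \<or> x = z \<or> y = z"
proof -
  obtain s c where u: "u = (s, c)" by fastforce
  have top: "(t = s + 1 \<and> b = c \<and> c \<noteq> 0 \<or> t = s \<and> (0 \<le> c \<and> b = c + 1 \<or> c \<le> 0 \<and> b = c - 1
      \<or> c = - L \<and> b = M \<and> M = L + 1)) \<and> - L \<le> b"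
    if "child L M u (t, b)" "(t, b) \<in> top_block" for t b
  proof -
    have "0 \<le> t" "t \<le> hi" "t + \<bar>b\<bar> = hi + 1" "- L \<le> b" using that(2) by (simp_all add: top_block_def)
    moreover have "(b = c \<and> (0 \<le> s \<and> t = s + 1 \<or> s \<le> 0 \<and> t = s - 1)) \<or>
        (t = s \<and> (0 \<le> c \<and> b = c + 1 \<or> c \<le> 0 \<and> b = c - 1 \<or> c = - L \<and> b = M \<and> M = L + 1))"
      using that(1) by (simp add: u child_def)
    ultimately show ?thesis by smt
  qed
  obtain x1 x2 y1 y2 z1 z2 where xyz: "x = (x1, x2)" "y = (y1, y2)" "z = (z1, z2)" by fastforce
  show ?thesis
    using top[of x1 x2] top[of y1 y2] top[of z1 z2] assms L_M unfolding xyz prod.inject by smt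
qed

text \<open>The vertices \<open>(- 1, L)\<close> and \<open>(- 1, - L)\<close> have a common parent
  only for \<open>L = 1\<close>, namely \<open>(- 1, 0)\<close>, and this is not a parent of
  \<open>(0, M)\<close>.\<close>

lemma extra_block_no_three_siblings:
  assumes "u \<in> Z" "child L M u x" "child L M u y" "child L M u z"
    and "x \<in> extra_block" "y \<in> extra_block" "z \<in> extra_block"
  shows "x = y \<or> x = z \<or> y = z"
proof (rule ccontr)
  assume "\<not> ?thesis"
  then have "{x, y, z} = {(0, M), (- 1, L), (- 1, - L)}"
    using assms(5-7) by (auto simp: extra_block_def split: if_splits)
  then have "child L M u (0, M)" "child L M u (- 1, L)" "child L M u (- 1, - L)"
    using assms(2-4) by (metis insertE insertI1 insertI2 singletonD)+
  moreover obtain s c where "u = (s, c)" by fastforce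
  ultimately show False using L_M unfolding child_def by simp smt
qed

lemma packing_disjoint:
  "packing \<inter> top_block = {}" "packing \<inter> extra_block = {}" "top_block \<inter> extra_block = {}"
proof -
  have False if "(t, b) \<in> packing" "(t, b) \<in> top_block" for t b
  proof -
    have "0 \<le> t" "t + \<bar>b\<bar> = hi + 1" using that(2) by (auto simp: top_block_def)
    then show False by (cases rule: packing_cases[OF that(1)]) auto
  qed
  then show "packing \<inter> top_block = {}" by auto
  have False if "(t, b) \<in> packing" "(t, b) \<in> extra_block" for t b
  proof -
    have sw: swapped and tb: "t = 0 \<and> b = M \<or> t = - 1"
      using that(2) by (auto simp: extra_block_def split: if_splits)
    then have "(0, M) \<notin> packing" by (auto simp: packing_def bottom_part_def extra_part_def)
    moreover have "even M" using sw unfolding swapped_def by metis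
    then have "t \<noteq> - 1" by (cases rule: packing_cases[OF that(1)]) auto
    ultimately show False using tb that(1) by auto
  qed
  then show "packing \<inter> extra_block = {}" by auto
  show "top_block \<inter> extra_block = {}"
    using L_M lo_hi by (auto simp: top_block_def extra_block_def swapped_def)
qed

lemma packing_separated:
  assumes "u \<in> Z" "child L M u z" "child L M u w" "z \<in> packing"
  shows "w \<notin> top_block \<union> extra_block"
proof
  assume w: "w \<in> top_block \<union> extra_block"
  obtain t b t' b' where zw: "z = (t, b)" "w = (t', b')" by fastforce
  have Z: "z \<in> Z" "w \<in> Z" using assms w packing_sub top_block_sub extra_block_sub by blast+
  have top: "t + \<bar>b\<bar> \<le> hi \<and> even b \<or> hi + 2 \<le> t + \<bar>b\<bar>"
    if "0 \<le> t" using assms(4)[unfolded zw] that by (cases rule: packing_cases) auto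
  have minus1: "lo = 1 \<and> odd M \<and> \<bar>b\<bar> = M" if "t = - 1"
    using assms(4)[unfolded zw] that by (cases rule: packing_cases) auto
  have range: "- lo \<le> t" "- lo \<le> t'" "t \<le> hi" "t' \<le> hi" "- L \<le> b" "- L \<le> b'" "b \<le> M" "b' \<le> M"
    using Z zw by auto
  show False
  proof (cases "w \<in> top_block")
    case True
    then have w': "0 \<le> t'" "t' + \<bar>b'\<bar> = hi + 1" by (auto simp: zw top_block_def)
    have "z \<noteq> w" using top w' by (auto simp: zw)
    note sib = siblings[OF assms(2,3)[unfolded zw] this[unfolded zw] Z[unfolded zw] assms(1)]
    have "t < 0" using sib(1) w' top by linarith
    then have t: "t = - 1" using sib(2) w' by linarith
    \<comment> \<open>A packing vertex in row \<open>- 1\<close> has level \<open>M + 1\<close>,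
      which must equal \<open>hi + 1\<close>. With \<open>lo = 1\<close> this forces
      \<open>L = 1\<close> and \<open>M = 2\<close>, whereas \<open>M\<close> is odd.\<close>
    note minus1[OF this]
    moreover have "even M" if "M = 2" using that by simp
    ultimately show False using sib t w' range L_M lo_hi hi_ge by smt
  next
    case False
    then have sw: "swapped" and w': "w \<in> {(0, M), (- 1, L), (- 1, - L)}"
      using w by (auto simp: extra_block_def split: if_splits)
    have M: "even M" "M = L + 1" "lo = 1" using sw by (auto simp: swapped_def)
    then have "0 \<le> t" using minus1 range by force
    have "z \<noteq> w"
      using assms(4) False w packing_disjoint(2) by auto
    note sib = siblings[OF assms(2,3)[unfolded zw] this[unfolded zw] Z[unfolded zw] assms(1)]
    \<comment> \<open>The whole extra block lies on level \<open>M \<le> hi\<close>, where the upper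
      half of the packing has only even columns.\<close>
    have "\<bar>t\<bar> + \<bar>b\<bar> = M" using sib(1) w' M L_M by (auto simp: zw)
    then have "even b" using top \<open>0 \<le> t\<close> hi_ge by auto
    have "(t, b) \<noteq> (0, M)"
      using assms(4) sw packing_disjoint(2) by (auto simp: zw extra_block_def)
    have "odd L" using M by simp
    from w' consider "t' = 0" "b' = M" | "t' = - 1" "\<bar>b'\<bar> = L" "odd b'" using \<open>odd L\<close> zw L_M by auto
    then show False
    proof cases
      case 1
      then have "\<bar>t\<bar> = 1" "odd (b - M)" using sib(2) L_M M by auto
      then show False using \<open>even b\<close> M by auto
    next
      case 2
      then have "t = 0 \<and> odd (b - b') \<or> t = 1 \<and> b = b'" using sib(2) \<open>0 \<le> t\<close> by linarith
      then show False using 2 \<open>even b\<close> \<open>\<bar>t\<bar> + \<bar>b\<bar> = M\<close> \<open>(t, b) \<noteq> (0, M)\<close> range M by auto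
    qed
  qed
qed

text \<open>Vertices with a common parent have equal levels, but the blocks lie on the levels
  \<open>hi + 1\<close> and \<open>M \<le> hi\<close>.\<close>

lemma blocks_separated:
  assumes "u \<in> Z" "child L M u z" "child L M u w" "z \<in> top_block"
  shows "w \<notin> extra_block"
proof
  assume w: "w \<in> extra_block"
  obtain t b t' b' where zw: "z = (t, b)" "w = (t', b')" by fastforce
  have "t + \<bar>b\<bar> = hi + 1" "0 \<le> t" using assms(4) by (auto simp: zw top_block_def)
  moreover have "\<bar>t'\<bar> + \<bar>b'\<bar> = M" "hi = L + M - 1"
    using w L_M lo_hi by (auto simp: zw extra_block_def swapped_def split: if_splits)
  moreover have "z \<in> Z" "w \<in> Z" using assms(4) w top_block_sub extra_block_sub by auto
  then have "\<bar>t\<bar> + \<bar>b\<bar> = \<bar>t'\<bar> + \<bar>b'\<bar>"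
    using assms(1-4) w packing_disjoint(3) unfolding zw by (intro siblings(1)) auto
  ultimately show False using L_M by linarith
qed

lemma packing_bound:
  assumes T: "T \<subseteq> Z"
    and f: "\<And>z. z \<in> Z - {(0, 0)} \<Longrightarrow> f z \<in> Z - T"
    and collision: "\<And>z w. z \<in> Z - {(0, 0)} \<Longrightarrow> w \<in> Z - {(0, 0)} \<Longrightarrow>
      f z = f w \<Longrightarrow> z \<noteq> w \<Longrightarrow> child L M (f z) z"
  shows "card T + card packing + (card top_block + 1) div 2 + (card extra_block + 1) div 2 \<le> card Z"
proof (rule charging_bound[where U = "Z - {(0, 0)}" and f = f and P = "child L M"])
  show "packing \<union> top_block \<union> extra_block \<subseteq> Z - {(0, 0)}"
    using packing_sub top_block_sub extra_block_sub by blast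
qed (fact T f collision packing_disjoint packing_no_siblings top_block_no_three_siblings
    extra_block_no_three_siblings packing_separated blocks_separated | blast | simp)+

section \<open>Size of the packing and the blocks\<close>

definition top_row_count :: "nat \<Rightarrow> int" where
  "top_row_count i = int (card {b \<in> {- L..M}. \<bar>b\<bar> \<le> int i \<and> even b}) +
    (if even i then int (card {b \<in> {- L..M}. int i + 2 \<le> \<bar>b\<bar>}) else 0)"

text \<open>Rows are indexed from the far end: \<open>top_row_count i\<close> counts the row
  \<open>hi - i\<close> of \<open>top_part\<close>. The root meets the condition on even columns and
  is counted too, hence the \<open>- 1\<close>.\<close>

lemma card_top_part: "(\<Sum>i < nat (hi + 1). top_row_count i) - 1 \<le> int (card top_part)"
proof -
  define R where "R t = {b \<in> {- L..M}. \<bar>b\<bar> \<le> hi - t \<and> even b} \<union>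
    (if even (hi - t) then {b \<in> {- L..M}. hi - t + 2 \<le> \<bar>b\<bar>} else {})" for t
  have fin: "finite (R t)" for t
    by (rule finite_subset[of _ "{- L..M}"]) (auto simp: R_def)
  have count: "int (card (R t)) = top_row_count (nat (hi - t))" if "t \<in> {0..hi}" for t
  proof (cases "even (hi - t)")
    case True
    have "int (card (R t)) = int (card {b \<in> {- L..M}. \<bar>b\<bar> \<le> hi - t \<and> even b}) +
        int (card {b \<in> {- L..M}. hi - t + 2 \<le> \<bar>b\<bar>})"
      unfolding R_def using True
      by (subst if_P, simp, subst card_Un_disjoint)
        (auto intro: finite_subset[of _ "{- L..M}"])
    then show ?thesis using True that by (simp add: top_row_count_def even_nat_iff)
  next
    case False
    then show ?thesis using that by (simp add: R_def top_row_count_def even_nat_iff)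
  qed
  have "(\<Sum>i < nat (hi + 1). top_row_count i) = (\<Sum>t \<in> {0..hi}. int (card (R t)))"
    by (rule sum.reindex_bij_witness[where i = "\<lambda>t. nat (hi - t)" and j = "\<lambda>i. hi - int i"])
      (use count in auto)
  also have "\<dots> = int (card (SIGMA t:{0..hi}. R t))" using fin by (simp add: card_SigmaI)
  finally have "(\<Sum>i < nat (hi + 1). top_row_count i) = int (card (SIGMA t:{0..hi}. R t))" .
  moreover have "card (SIGMA t:{0..hi}. R t) - 1 \<le> card ((SIGMA t:{0..hi}. R t) - {(0, 0)})"
    by (rule order_trans[OF _ diff_card_le_card_Diff]) simp_all
  moreover have "card ((SIGMA t:{0..hi}. R t) - {(0, 0)}) \<le> card top_part"
  proof (rule card_mono)
    show "finite top_part" by (rule finite_sub_Z) (auto simp: top_part_def)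
    show "(SIGMA t:{0..hi}. R t) - {(0, 0)} \<subseteq> top_part"
      using lo_hi by (auto simp: R_def top_part_def split: if_splits)
  qed
  ultimately show ?thesis by linarith
qed

lemma top_row_count_ge:
  assumes "M = L + 1 \<or> odd M"
  shows "M \<le> int i \<Longrightarrow> M \<le> top_row_count i"
    and "int i < M \<Longrightarrow> 2 * (int i div 2) + 1 \<le> top_row_count i"
    and "int i < M \<Longrightarrow> even i \<Longrightarrow> L + M - 1 - int i \<le> top_row_count i"
proof -
  have "int (card {b \<in> {- L..M}. \<bar>b\<bar> \<le> int i \<and> even b}) \<le> top_row_count i"
    by (simp add: top_row_count_def)
  then show "M \<le> int i \<Longrightarrow> M \<le> top_row_count i"
      "int i < M \<Longrightarrow> 2 * (int i div 2) + 1 \<le> top_row_count i"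
    using card_even_ge[of M "int i" L] card_even_le[of "int i" L M] L_M assms by auto
  show "L + M - 1 - int i \<le> top_row_count i" if "int i < M" "even i"
  proof -
    have "int (card {b \<in> {- L..M}. \<bar>b\<bar> \<le> int i \<and> even b}) = 2 * (int i div 2) + 1"
      using that L_M by (intro card_even_le) auto
    moreover have "2 * (int i div 2) = int i" using that(2) by presburger
    moreover have "L + M + 2 - 2 * (int i + 2) \<le> int (card {b \<in> {- L..M}. int i + 2 \<le> \<bar>b\<bar>})"
      using L_M by (intro card_far_ge) auto
    ultimately show ?thesis using that by (simp add: top_row_count_def)
  qed
qed

text \<open>Each row with \<open>i \<ge> M\<close> contributes at least \<open>M\<close>, and the
  rows \<open>2 * l\<close> and \<open>2 * l + 1\<close> below \<open>M\<close> together at least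
  \<open>L + M\<close>. For odd \<open>M\<close> the row \<open>M - 1\<close> is left over and
  contributes \<open>M\<close>. The block has a vertex in every column except 0, so it is worth at
  least \<open>M\<close>.\<close>

lemma top_total:
  assumes "M = L + 1 \<or> odd M"
  shows "(hi + 1) * M - 1 + (if M = L then M else (M + 1) div 2)
    \<le> int (card top_part) + int ((card top_block + 1) div 2)"
proof -
  define q where "q = nat (M div 2)"
  define N where "N = nat (hi + 1)"
  have M: "M = 2 * int q \<or> M = 2 * int q + 1" using L_M by (auto simp: q_def)
  have N: "int N = hi + 1" "2 * q \<le> N" "nat M \<le> N" using hi_ge L_M M by (auto simp: N_def)
  have pairs: "int q * (L + M) \<le> (\<Sum>i < 2 * q. top_row_count i)"
  proof (rule sum_pairs_ge)
    fix l assume "l < q"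
    then have l: "int (2 * l + 1) < M" using M by auto
    have "L + M - 1 - int (2 * l) \<le> top_row_count (2 * l)"
      using l by (intro top_row_count_ge(3)[OF assms]) auto
    moreover have "2 * (int (2 * l + 1) div 2) + 1 \<le> top_row_count (2 * l + 1)"
      using l by (intro top_row_count_ge(2)[OF assms]) auto
    moreover have "int (2 * l + 1) div 2 = int l" by simp
    ultimately show "L + M \<le> top_row_count (2 * l) + top_row_count (2 * l + 1)" by simp
  qed
  have low: "int q * (L + M) + (if odd M then M else 0) \<le> (\<Sum>i < nat M. top_row_count i)"
  proof (cases "odd M")
    case True
    then have Mq: "M = 2 * int q + 1" using M by auto
    then have "nat M = Suc (2 * q)" by simp
    moreover have "2 * (int (2 * q) div 2) + 1 \<le> top_row_count (2 * q)"
      using Mq by (intro top_row_count_ge(2)[OF assms]) auto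
    ultimately show ?thesis using pairs True Mq by simp
  next
    case False
    then have "nat M = 2 * q" using M by auto
    then show ?thesis using pairs False by simp
  qed
  have "(\<Sum>i \<in> {nat M..<N}. M) \<le> (\<Sum>i \<in> {nat M..<N}. top_row_count i)"
    using L_M by (intro sum_mono top_row_count_ge(1)[OF assms]) auto
  moreover have "(\<Sum>i \<in> {nat M..<N}. M) = (hi + 1 - M) * M"
  proof -
    have "int (N - nat M) = hi + 1 - M" using N L_M by (simp only: of_nat_diff) auto
    then show ?thesis by simp
  qed
  moreover have "(\<Sum>i < N. top_row_count i) =
      (\<Sum>i < nat M. top_row_count i) + (\<Sum>i \<in> {nat M..<N}. top_row_count i)"
    using N(3) by (metis lessThan_atLeast0 le0 sum.atLeastLessThan_concat)
  ultimately have sum: "int q * (L + M) + (if odd M then M else 0) + (hi + 1 - M) * M - 1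
      \<le> int (card top_part)"
    using low card_top_part[folded N_def] by linarith
  have "(\<lambda>b. (hi + 1 - \<bar>b\<bar>, b)) ` ({- L..M} - {0}) \<subseteq> top_block"
    using hi_ge L_M lo_hi by (auto simp: top_block_def)
  then have "card ((\<lambda>b. (hi + 1 - \<bar>b\<bar>, b)) ` ({- L..M} - {0})) \<le> card top_block"
    using top_block_sub by (intro card_mono finite_sub_Z) auto
  moreover have "card ((\<lambda>b. (hi + 1 - \<bar>b\<bar>, b)) ` ({- L..M} - {0})) = card ({- L..M} - {0})"
    by (rule card_image) (simp add: inj_on_def)
  moreover have "int (card ({- L..M} - {0})) = L + M" using L_M by auto
  ultimately have "L + M \<le> int (card top_block)" by linarith
  then have block: "M \<le> int ((card top_block + 1) div 2)" using L_M(1) by linarith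
  have "int q * (L + M) + (if odd M then M else 0) + (hi + 1 - M) * M - 1 + M
      = (hi + 1) * M - 1 + (if M = L then M else (M + 1) div 2)"
  proof -
    consider "M = L" "M = 2 * int q + 1" | "M = L + 1" "M = 2 * int q + 1" | "M = L + 1" "M = 2 * int q"
      using M L_M(1) assms by auto
    then show ?thesis
    proof cases
      case 1
      then have "L = 2 * int q + 1" by simp
      then show ?thesis unfolding 1(2) by (simp only:) (simp add: algebra_simps)
    next
      case 2
      then have "L = 2 * int q" by simp
      then show ?thesis unfolding 2(2) by (simp only:) (simp add: algebra_simps)
    next
      case 3
      then have "L = 2 * int q - 1" by simp
      then show ?thesis unfolding 3(2) by (simp only:) (simp add: algebra_simps)
    qed
  qed
  then show ?thesis using sum block by linarith
qed

text \<open>Every second row from \<open>- 2\<close> to \<open>- lo\<close> contributes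
  \<open>L + M\<close> vertices. For \<open>M = L + 1\<close> the total is
  \<open>lo * M - lo div 2\<close>, which suffices because \<open>lo \<le> L\<close>.\<close>

lemma bottom_even:
  assumes "even lo" "2 \<le> lo" "M = L + 1 \<or> odd M"
  shows "(lo - 1) * M + (if M = L then 2 else 1) \<le> int (card bottom_part)"
proof -
  define p where "p = lo div 2"
  have p: "lo = 2 * p" "1 \<le> p" using assms by (auto simp: p_def)
  have "(\<lambda>j. - 2 * j) ` {1..p} \<times> ({- L..M} - {- 1}) \<subseteq> bottom_part"
    unfolding bottom_part_def using assms(1) p lo_hi by auto
  then have "card ((\<lambda>j. - 2 * j) ` {1..p} \<times> ({- L..M} - {- 1})) \<le> card bottom_part"
    by (intro card_mono finite_sub_Z) (auto simp: bottom_part_def)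
  moreover have "card ((\<lambda>j. - 2 * j) ` {1..p} \<times> ({- L..M} - {- 1})) = nat p * nat (L + M)"
  proof -
    have "card ((\<lambda>j. - 2 * j) ` {1..p}) = nat p" by (subst card_image) (auto simp: inj_on_def)
    moreover have "card ({- L..M} - {- 1}) = nat (L + M)" using L_M by auto
    ultimately show ?thesis by (simp only: card_cartesian_product)
  qed
  ultimately have *: "nat p * nat (L + M) \<le> card bottom_part" by simp
  have "p * (L + M) \<le> int (card bottom_part)"
  proof -
    have "int (nat p * nat (L + M)) = p * (L + M)" using p L_M by simp
    then show ?thesis using * by linarith
  qed
  moreover have "(lo - 1) * M + (if M = L then 2 else 1) \<le> p * (L + M)"
    using p L_M lo_le by (auto simp: algebra_simps)
  ultimately show ?thesis by linarith
qed

lemma bottom_odd: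
  assumes "odd lo" "2 \<le> lo"
  shows "(lo - 1) * M + (if M = L then 2 else 1) \<le> int (card bottom_part)"
proof -
  define q where "q = nat ((lo - 1) div 2)"
  have q: "lo = 2 * int q + 1" "1 \<le> q" using assms by (auto simp: q_def elim!: oddE)
  define R where "R t = {b \<in> {- L..M}. \<bar>b\<bar> \<le> M + 1 + t \<and> even b} \<union>
    (if odd t then {b \<in> {- L..M}. M + 2 + t \<le> \<bar>b\<bar>} else {})" for t
  define H where "H i = int (card (R (- int i - 2)))" for i
  have fin: "finite (R t)" for t
    by (rule finite_subset[of _ "{- L..M}"]) (auto simp: R_def)
  have "int q * (L + M + 2) \<le> (\<Sum>i < 2 * q. H i)"
  proof (rule sum_pairs_ge)
    fix l assume "l < q"
    then have l: "2 * int l + 3 \<le> L" using q lo_le by linarith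
    \<comment> \<open>In absolute value, the row \<open>- 2 * l - 2\<close> has the even columns up
      to \<open>y\<close>, and the row \<open>- 2 * l - 3\<close> the even columns up to
      \<open>y - 1\<close> together with all columns from \<open>y\<close> on.\<close>
    define y where "y = M - 1 - 2 * int l"
    have "H (2 * l) = int (card {b \<in> {- L..M}. \<bar>b\<bar> \<le> y \<and> even b})"
      by (simp add: H_def R_def y_def algebra_simps)
    also have "\<dots> = 2 * (y div 2) + 1" using l L_M by (intro card_even_le) (auto simp: y_def)
    finally have 1: "H (2 * l) = 2 * (y div 2) + 1" .
    have "H (2 * l + 1) = int (card ({b \<in> {- L..M}. \<bar>b\<bar> \<le> y - 1 \<and> even b} \<union> {b \<in> {- L..M}. y \<le> \<bar>b\<bar>}))"
      by (simp add: H_def R_def y_def algebra_simps)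
    also have "\<dots> = int (card {b \<in> {- L..M}. \<bar>b\<bar> \<le> y - 1 \<and> even b}) + int (card {b \<in> {- L..M}. y \<le> \<bar>b\<bar>})"
      by (subst card_Un_disjoint) (auto intro: finite_subset[of _ "{- L..M}"])
    also have "\<dots> \<ge> (2 * ((y - 1) div 2) + 1) + (L + M + 2 - 2 * y)"
      using l L_M card_even_le[of "y - 1" L M] card_far_ge[of y L M] by (auto simp: y_def)
    finally have 2: "(2 * ((y - 1) div 2) + 1) + (L + M + 2 - 2 * y) \<le> H (2 * l + 1)" .
    have "y div 2 + (y - 1) div 2 = y - 1" by presburger
    then show "L + M + 2 \<le> H (2 * l) + H (2 * l + 1)" using 1 2 by linarith
  qed
  also have "(\<Sum>i < 2 * q. H i) = (\<Sum>t \<in> {- lo..- 2}. int (card (R t)))"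
    by (rule sum.reindex_bij_witness[where i = "\<lambda>t. nat (- t - 2)" and j = "\<lambda>i. - int i - 2"])
      (use q in \<open>auto simp: H_def\<close>)
  also have "\<dots> = int (card (SIGMA t:{- lo..- 2}. R t))" using fin by (simp add: card_SigmaI)
  also have "card (SIGMA t:{- lo..- 2}. R t) \<le> card bottom_part"
  proof (rule card_mono)
    show "finite bottom_part" by (rule finite_sub_Z) (auto simp: bottom_part_def)
    show "(SIGMA t:{- lo..- 2}. R t) \<subseteq> bottom_part"
      unfolding bottom_part_def using lo_hi assms(1) by (auto simp: R_def split: if_splits)
  qed
  finally have "int q * (L + M + 2) \<le> int (card bottom_part)" by simp
  moreover have "(lo - 1) * M + (if M = L then 2 else 1) \<le> int q * (L + M + 2)"
    using q L_M by (auto simp: algebra_simps)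
  ultimately show ?thesis by linarith
qed

text \<open>Beyond \<open>top_total\<close>, the negative rows must supply
  \<open>(lo - 1) * M\<close> plus 1 or 2. For \<open>lo = 0\<close> this is not positive. For
  \<open>lo = 1\<close> it comes from \<open>extra_part\<close>, or from exchanging one packing
  vertex for a block worth 2. For \<open>lo \<ge> 2\<close> it comes from
  \<open>bottom_part\<close>.\<close>

lemma packing_total:
  assumes "M = L + 1 \<or> odd M"
  shows "(L + M) * M + (if M = L then M + 1 else (M + 1) div 2)
    \<le> int (card packing) + int ((card top_block + 1) div 2) + int ((card extra_block + 1) div 2)"
proof -
  have union: "int (card A) + int (card B) \<le> int (card packing)"
    if "A \<union> B \<subseteq> packing" "A \<inter> B = {}" for A B
  proof -
    have "finite packing" using packing_sub by (intro finite_sub_Z) auto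
    then have "finite (A \<union> B)" "card (A \<union> B) \<le> card packing"
      using that(1) by (auto intro: card_mono finite_subset)
    moreover from this(1) have "card (A \<union> B) = card A + card B"
      using that(2) by (intro card_Un_disjoint) auto
    ultimately show ?thesis by linarith
  qed
  have top_nonneg: "0 \<le> t" if "(t, b) \<in> top_part" for t b
    using that by (simp add: top_part_def)
  have disjoint: "top_part \<inter> B = {}" if "\<And>t b. (t, b) \<in> B \<Longrightarrow> t < 0" for B
    using that top_nonneg by (force simp: not_le[symmetric])
  consider "lo = 0" | "lo = 1" "\<not> swapped" | swapped | "2 \<le> lo" using lo_hi(1) by linarith
  then have "(L + M) * M - (hi + 1) * M + (if M = L then 2 else 1) + int (card top_part)
    \<le> int (card packing) + int ((card extra_block + 1) div 2)"
  proof cases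
    case 1
    then have "\<not> swapped" unfolding swapped_def by simp
    then have "top_part \<union> {} \<subseteq> packing" by (auto simp: packing_def)
    then have "int (card top_part) \<le> int (card packing)" using union[of top_part "{}"] by simp
    moreover have "(L + M) * M - (hi + 1) * M = - M" using 1 lo_hi by (simp add: algebra_simps)
    ultimately show ?thesis using L_M by auto
  next
    case 2
    define E where "E = (if M = L then {(- 1, M), (- 1, - M)} else {(- 1 :: int, M)})"
    have "odd M" using 2 assms unfolding swapped_def by auto
    then have "E \<subseteq> extra_part" unfolding E_def extra_part_def using 2 by auto
    then have "top_part \<union> E \<subseteq> packing" using 2(2) by (auto simp: packing_def)
    moreover have "top_part \<inter> E = {}" by (rule disjoint) (auto simp: E_def split: if_splits)
    moreover have "int (card E) = (if M = L then 2 else 1)" using L_M by (auto simp: E_def)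
    ultimately have "int (card top_part) + (if M = L then 2 else 1) \<le> int (card packing)"
      using union[of top_part E] by simp
    moreover have "(L + M) * M - (hi + 1) * M = 0" using 2 lo_hi by (simp add: algebra_simps)
    ultimately show ?thesis by linarith
  next
    case 3
    then have "(top_part - {(0, M)}) \<union> {} \<subseteq> packing" by (auto simp: packing_def)
    then have "int (card (top_part - {(0, M)})) \<le> int (card packing)"
      using union[of "top_part - {(0, M)}" "{}"] by simp
    moreover have "card top_part - 1 \<le> card (top_part - {(0, M)})"
      by (rule order_trans[OF _ diff_card_le_card_Diff]) simp_all
    moreover have "card extra_block = 3" using 3 L_M by (auto simp: extra_block_def)
    then have "int ((card extra_block + 1) div 2) = 2" by simp
    moreover have "(L + M) * M - (hi + 1) * M = 0"
      using 3 lo_hi unfolding swapped_def by (simp add: algebra_simps)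
    moreover have "(if M = L then 2 else 1 :: int) = 1" using 3 unfolding swapped_def by simp
    ultimately show ?thesis by linarith
  next
    case 4
    then have "\<not> swapped" unfolding swapped_def by simp
    then have "top_part \<union> bottom_part \<subseteq> packing" by (auto simp: packing_def)
    moreover have "top_part \<inter> bottom_part = {}" by (rule disjoint) (auto simp: bottom_part_def)
    ultimately have "int (card top_part) + int (card bottom_part) \<le> int (card packing)"
      by (rule union)
    moreover have "(lo - 1) * M + (if M = L then 2 else 1) \<le> int (card bottom_part)"
      using bottom_even bottom_odd 4 assms by metis
    moreover have "(L + M) * M - (hi + 1) * M = (lo - 1) * M"
      unfolding lo_hi(3)[symmetric] by (simp add: algebra_simps)
    ultimately show ?thesis by linarith
  qed
  then show ?thesis using top_total[OF assms] by (auto split: if_splits)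
qed

lemma box_bound:
  assumes T: "T \<subseteq> Z"
    and f: "\<And>z. z \<in> Z - {(0, 0)} \<Longrightarrow> f z \<in> Z - T"
    and collision: "\<And>z w. z \<in> Z - {(0, 0)} \<Longrightarrow> w \<in> Z - {(0, 0)} \<Longrightarrow>
      f z = f w \<Longrightarrow> z \<noteq> w \<Longrightarrow> child L M (f z) z"
  shows "int (card T) + (if M = L then if even M then 2 * M * (M + 1) - 1 else 2 * M * M + M + 1
    else (L + M) * M + (M + 1) div 2) \<le> (L + M + 1) * (L + M + 1)"
proof (cases "M = L \<and> even M")
  case True
  then have "even L" "M = L" by metis+
  then have "int (card T) + 2 * L * (L + 1) - 1 \<le> (L + M + 1) * (L + M + 1)"
    by (rule columns_bound[where f = f]) (fact T f collision)+
  then show ?thesis using True by (elim conjE) simp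
next
  case False
  then have M: "M = L + 1 \<or> odd M" using L_M by auto
  have "card T + card packing + (card top_block + 1) div 2 + (card extra_block + 1) div 2 \<le> card Z"
    by (rule packing_bound[where f = f]) (fact T f collision)+
  then have "int (card T) + int (card packing) + int ((card top_block + 1) div 2)
      + int ((card extra_block + 1) div 2) \<le> (L + M + 1) * (L + M + 1)"
    using card_Z by linarith
  moreover have "(if M = L then if even M then 2 * M * (M + 1) - 1 else 2 * M * M + M + 1
      else (L + M) * M + (M + 1) div 2) = (L + M) * M + (if M = L then M + 1 else (M + 1) div 2)"
    using False by (simp add: algebra_simps)
  ultimately show ?thesis using packing_total[OF M] by linarith
qed

end

section \<open>The lower bound in coordinates\<close>

lemma child_row: "1 \<le> t \<Longrightarrow> child L M (t - 1, b) (t, b)"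
  and child_row_neg: "child L M (0, b) (- 1, b)"
  and child_col: "b \<noteq> 0 \<Longrightarrow> child L M (t, b - sgn b) (t, b)"
  by (auto simp: child_def sgn_if)

lemma abs_diff_sgn: "b \<noteq> 0 \<Longrightarrow> \<bar>b - sgn b\<bar> = \<bar>b\<bar> - 1" for b :: int
  by (auto simp: sgn_if)

lemma even_diff_sgn: "b \<noteq> 0 \<Longrightarrow> even (b - sgn b) \<longleftrightarrow> odd b" for b :: int
  by (auto simp: sgn_if)

text \<open>In all three constructions the root lies at distance 1 from an end of the path.\<close>

locale box1 =
  fixes L M hi :: int
  assumes L_M: "M = L \<or> M = L + 1" "1 \<le> L" "3 \<le> L + M" and hi: "hi = L + M - 1"
begin

abbreviation "Z \<equiv> {- 1..hi} \<times> {- L..M}"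

lemma M_ge: "2 \<le> M" and hi_ge: "2 \<le> hi"
  using L_M hi by linarith+

lemma diff_sgn_range: "b \<in> {- L..M} \<Longrightarrow> b - sgn b \<in> {- L..M}"
  using L_M by (auto simp: sgn_if)

text \<open>The even rows from 0 to \<open>hi - 1\<close> cover the odd rows, the row
  \<open>- 1\<close> and, by column steps towards 0, themselves except for column 0. The set
  \<open>B\<close> of vertices in column 0 covers the rest.\<close>

lemma even_rows_cover:
  assumes "M = L"
  shows "\<exists>R \<subseteq> Z. (0, 0) \<in> R \<and> (\<forall>z \<in> Z. z \<noteq> (0, 0) \<longrightarrow> (\<exists>u \<in> R. child L M u z)) \<and>
    int (card R) \<le> 2 * M * (M + 1) - 1"
proof -
  define A where "A = (\<lambda>i. 2 * i) ` {0..L - 1} \<times> {- L..M}"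
  define B where "B = (\<lambda>i. (2 * i + 1, 0 :: int)) ` {0..L - 2}"
  have A: "(t, b) \<in> A" if "0 \<le> t" "t \<le> hi" "even t" "b \<in> {- L..M}" for t b
    using that hi assms by (auto simp: A_def elim!: evenE)
  have B: "(t, 0) \<in> B" if "0 \<le> t" "t < hi" "odd t" for t
    using that hi assms by (auto simp: B_def elim!: oddE)
  have "A \<union> B \<subseteq> Z" using hi assms L_M by (auto simp: A_def B_def)
  moreover have "(0, 0) \<in> A \<union> B" using A[of 0 0] hi L_M by auto
  moreover have "\<exists>u \<in> A \<union> B. child L M u z" if z: "z \<in> Z" "z \<noteq> (0, 0)" for z
  proof -
    obtain t b where tb: "z = (t, b)" by fastforce
    then have range: "- 1 \<le> t" "t \<le> hi" "b \<in> {- L..M}" using z by auto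
    consider "t = - 1" | "0 \<le> t" "odd t" | "0 \<le> t" "even t" "b \<noteq> 0" | "1 \<le> t" "even t" "b = 0"
      using range(1) z(2) tb by force
    then show ?thesis
    proof cases
      case 1
      then show ?thesis using A[of 0 b] child_row_neg range hi L_M tb by (intro bexI[of _ "(0, b)"]) auto
    next
      case 2
      then have "1 \<le> t" by presburger
      then show ?thesis using A[of "t - 1" b] child_row[of t L M b] 2 range tb
        by (intro bexI[of _ "(t - 1, b)"]) auto
    next
      case 3
      then show ?thesis using A[of t "b - sgn b"] child_col[of b L M t] range diff_sgn_range tb
        by (intro bexI[of _ "(t, b - sgn b)"]) auto
    next
      case 4
      then show ?thesis using B[of "t - 1"] child_row[of t L M b] range tb
        by (intro bexI[of _ "(t - 1, b)"]) auto
    qed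
  qed
  moreover have "int (card (A \<union> B)) \<le> 2 * M * (M + 1) - 1"
  proof -
    have "card ((\<lambda>i. 2 * i) ` {0..L - 1}) \<le> card {0..L - 1}" by (rule card_image_le) simp
    then have "card A \<le> card {0..L - 1} * card {- L..M}"
      unfolding A_def card_cartesian_product by (rule mult_le_mono1)
    moreover have "card B \<le> card {0..L - 2}" unfolding B_def by (rule card_image_le) simp
    ultimately have "card (A \<union> B) \<le> card {0..L - 1} * card {- L..M} + card {0..L - 2}"
      using card_Un_le[of A B] by linarith
    moreover have "int (card {0..L - 1} * card {- L..M} + card {0..L - 2}) = L * (2 * L + 1) + (L - 1)"
      using L_M assms by simp
    ultimately have "int (card (A \<union> B)) \<le> L * (2 * L + 1) + (L - 1)" by linarith
    then show ?thesis using assms by (simp add: algebra_simps)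
  qed
  ultimately show ?thesis by (intro exI[of _ "A \<union> B"]) simp
qed

text \<open>Row 0 without its ends covers row 0 and, except for its ends, the row
  \<open>- 1\<close>; two further vertices cover these ends. In the rows from 1 on, an even column
  is covered from the row before and an odd one from the even column next to it towards 0.\<close>

lemma even_columns_cover:
  assumes "M = L" "odd M"
  shows "\<exists>R \<subseteq> Z. (0, 0) \<in> R \<and> (\<forall>z \<in> Z. z \<noteq> (0, 0) \<longrightarrow> (\<exists>u \<in> R. child L M u z)) \<and>
    int (card R) \<le> 2 * M * M + M + 1"
proof -
  define E where "E = {b \<in> {- L..M}. \<bar>b\<bar> \<le> M \<and> even b}"
  define R where "R = {0} \<times> {- (M - 1)..M - 1} \<union> {(- 1, M - 1), (- 1, 1 - M)} \<union> {1..hi} \<times> E"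
  have "R \<subseteq> Z" using hi assms L_M by (auto simp: R_def E_def)
  moreover have "(0, 0) \<in> R" using L_M assms by (auto simp: R_def)
  moreover have "\<exists>u \<in> R. child L M u z" if z: "z \<in> Z" "z \<noteq> (0, 0)" for z
  proof -
    obtain t b where tb: "z = (t, b)" by fastforce
    then have range: "- 1 \<le> t" "t \<le> hi" "\<bar>b\<bar> \<le> M" using z assms(1) by auto
    consider "t = - 1" "\<bar>b\<bar> \<le> M - 1" | "t = - 1" "\<bar>b\<bar> = M" | "t = 0" "b \<noteq> 0"
      | "1 \<le> t" "even b" | "1 \<le> t" "odd b"
      using range z(2) tb by force
    then show ?thesis
    proof cases
      case 1
      then show ?thesis using child_row_neg tb by (intro bexI[of _ "(0, b)"]) (auto simp: R_def)
    next
      case 2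
      then have "b \<noteq> 0" "b - sgn b = M - 1 \<or> b - sgn b = 1 - M" using L_M assms by (auto simp: sgn_if)
      then show ?thesis using child_col[of b L M t] 2 tb
        by (intro bexI[of _ "(t, b - sgn b)"]) (auto simp: R_def)
    next
      case 3
      then show ?thesis using child_col[of b L M t] abs_diff_sgn[of b] range tb
        by (intro bexI[of _ "(t, b - sgn b)"]) (auto simp: R_def)
    next
      case 4
      then have "\<bar>b\<bar> \<noteq> M" using assms(2) by (metis dvd_abs_iff)
      then have "(t - 1, b) \<in> R"
        using 4 range assms(1) by (cases "t = 1") (auto simp: R_def E_def)
      then show ?thesis using child_row[of t L M b] 4 tb by blast
    next
      case 5
      then have "b \<noteq> 0" by auto
      then have "(t, b - sgn b) \<in> R"
        using 5 range abs_diff_sgn[of b] even_diff_sgn[of b] assms(1) by (auto simp: R_def E_def)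
      then show ?thesis using child_col[of b L M t] \<open>b \<noteq> 0\<close> tb by blast
    qed
  qed
  moreover have "int (card R) \<le> 2 * M * M + M + 1"
  proof -
    have "card R \<le> card ({0 :: int} \<times> {- (M - 1)..M - 1}) + card {(- 1 :: int, M - 1), (- 1, 1 - M)}
        + card ({1..hi} \<times> E)"
      unfolding R_def by (meson add_mono card_Un_le order_refl order_trans)
    moreover have "card {(- 1 :: int, M - 1), (- 1, 1 - M)} \<le> 2" by (simp add: card_insert_if)
    moreover have "int (card ({0 :: int} \<times> {- (M - 1)..M - 1})) = 2 * M - 1"
      using M_ge by (simp add: card_cartesian_product)
    moreover have "int (card ({1..hi} \<times> E)) = (2 * M - 1) * M"
    proof -
      have "int (card E) = M" unfolding E_def using L_M assms by (intro card_even_ge) auto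
      moreover have "int (card {1..hi}) = 2 * M - 1" using hi M_ge assms(1) by simp
      ultimately show ?thesis by (simp only: card_cartesian_product of_nat_mult)
    qed
    ultimately have "int (card R) \<le> (2 * M - 1) + 2 + (2 * M - 1) * M" by linarith
    then show ?thesis by (simp add: algebra_simps)
  qed
  ultimately show ?thesis by (intro exI[of _ R]) simp
qed

text \<open>Row 0 is taken completely and covers the rows \<open>- 1\<close> and 1. In higher rows,
  \<open>Q t\<close> has the even columns up to the diagonals through \<open>(hi, 0)\<close> and,
  beyond them, the rows with \<open>hi - t\<close> odd. Up to level \<open>hi + 1\<close>, even
  columns are covered by row steps and odd ones by column steps; on higher levels, the parity of
  \<open>hi - t\<close> decides in the same way.\<close>

lemma staircase_cover:
  assumes "M = L + 1"
  shows "\<exists>R \<subseteq> Z. (0, 0) \<in> R \<and> (\<forall>z \<in> Z. z \<noteq> (0, 0) \<longrightarrow> (\<exists>u \<in> R. child L M u z)) \<and>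
    int (card R) \<le> (L + M) * M + (M + 1) div 2"
proof -
  define Q where "Q t = {b \<in> {- L..M}. \<bar>b\<bar> \<le> hi - t \<and> even b} \<union>
    (if odd (hi - t) then {b \<in> {- L..M}. hi - t + 1 \<le> \<bar>b\<bar>} else {})" for t
  define R where "R = {0} \<times> {- L..M} \<union> (SIGMA t:{1..hi}. Q t)"
  have "R \<subseteq> Z" using hi_ge by (auto simp: R_def Q_def split: if_splits)
  moreover have "(0, 0) \<in> R" using L_M by (auto simp: R_def)
  moreover have "\<exists>u \<in> R. child L M u z" if z: "z \<in> Z" "z \<noteq> (0, 0)" for z
  proof -
    obtain t b where tb: "z = (t, b)" by fastforce
    then have range: "- 1 \<le> t" "t \<le> hi" "b \<in> {- L..M}" using z by auto
    consider "t = - 1 \<or> t = 1" | "t = 0" "b \<noteq> 0"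
      | "2 \<le> t" "t + \<bar>b\<bar> \<le> hi + 1 \<and> even b \<or> hi + 2 \<le> t + \<bar>b\<bar> \<and> even (hi - t)"
      | "2 \<le> t" "t + \<bar>b\<bar> \<le> hi + 1 \<and> odd b \<or> hi + 2 \<le> t + \<bar>b\<bar> \<and> odd (hi - t)"
      using range(1) z(2) unfolding tb prod.inject by smt
    then show ?thesis
    proof cases
      case 1
      then have "child L M (0, b) z" using child_row_neg child_row[of t L M b] tb by auto
      then show ?thesis using range by (intro bexI[of _ "(0, b)"]) (auto simp: R_def)
    next
      case 2
      then show ?thesis using child_col[of b L M t] diff_sgn_range[OF range(3)] tb
        by (intro bexI[of _ "(t, b - sgn b)"]) (auto simp: R_def)
    next
      case 3
      then have "b \<in> Q (t - 1)" using range by (auto simp: Q_def)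
      then have "(t - 1, b) \<in> R" using 3 range by (auto simp: R_def)
      then show ?thesis using child_row[of t L M b] 3 tb by force
    next
      case 4
      then have "b \<noteq> 0" using range by auto
      then have "b - sgn b \<in> Q t"
        using 4 range(2) diff_sgn_range[OF range(3)] abs_diff_sgn[of b] even_diff_sgn[of b]
        by (auto simp: Q_def)
      then have "(t, b - sgn b) \<in> R" using 4 range by (auto simp: R_def)
      then show ?thesis using child_col[of b L M t] \<open>b \<noteq> 0\<close> tb by blast
    qed
  qed
  moreover have "int (card R) \<le> (L + M) * M + (M + 1) div 2"
  proof -
    define F where "F i = int (card (Q (hi - int i)))" for i
    have fin: "finite (Q t)" for t
      by (rule finite_subset[of _ "{- L..M}"]) (auto simp: Q_def)
    define q where "q = nat (M div 2)"
    have M: "M = 2 * int q \<or> M = 2 * int q + 1" using L_M by (auto simp: q_def)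
    have even_row: "F i = 2 * (int i div 2) + 1" if "even i" "int i < M" for i
      unfolding F_def Q_def using that card_even_le[of "int i" L M] assms by simp
    have "(\<Sum>i < 2 * q. F i) \<le> int q * (2 * M - 1)"
    proof (rule sum_pairs_le)
      fix l assume "l < q"
      then have l: "int (2 * l + 1) < M" using M by auto
      have "F (2 * l + 1) \<le> int (card {b \<in> {- L..M}. \<bar>b\<bar> \<le> int (2 * l + 1) \<and> even b}) +
          int (card {b \<in> {- L..M}. int (2 * l + 1) + 1 \<le> \<bar>b\<bar>})"
        unfolding F_def Q_def using card_Un_le by (simp flip: of_nat_add)
      also have "\<dots> = 2 * (int (2 * l + 1) div 2) + 1 + (L + M + 2 - 2 * (int (2 * l + 1) + 1))"
        using l assms card_even_le[of "int (2 * l + 1)" L M] card_far[of "int (2 * l + 1) + 1" L M] by simp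
      finally show "F (2 * l) + F (2 * l + 1) \<le> 2 * M - 1"
        using even_row[of "2 * l"] l assms by simp
    qed
    moreover have "F (2 * q) = M" if "odd M"
      using even_row[of "2 * q"] M that by auto
    ultimately have low: "(\<Sum>i < nat M. F i) \<le> int q * (2 * M - 1) + (if odd M then M else 0)"
    proof (cases "odd M")
      case True
      then have "nat M = Suc (2 * q)" using M by auto
      then show ?thesis using \<open>(\<Sum>i < 2 * q. F i) \<le> _\<close> \<open>odd M \<Longrightarrow> F (2 * q) = M\<close> True by simp
    next
      case False
      then have "nat M = 2 * q" using M by auto
      then show ?thesis using \<open>(\<Sum>i < 2 * q. F i) \<le> _\<close> False by simp
    qed
    have full: "F i \<le> M" if "M \<le> int i" for i
    proof -
      have "\<bar>b\<bar> \<le> int i" if "b \<in> {- L..M}" for b using that \<open>M \<le> int i\<close> assms by auto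
      then have "Q (hi - int i) = {b \<in> {- L..M}. \<bar>b\<bar> \<le> int i \<and> even b}"
        by (force simp: Q_def)
      then show ?thesis
        using card_even_ge[of M "int i" L] that L_M assms by (simp add: F_def)
    qed
    have "(\<Sum>i \<in> {nat M..<nat hi}. F i) \<le> (\<Sum>i \<in> {nat M..<nat hi}. M)"
      using L_M by (intro sum_mono full) auto
    moreover have "(\<Sum>i \<in> {nat M..<nat hi}. M) = (hi - M) * M"
    proof -
      have "M \<le> hi" using hi L_M(2) by simp
      then have "int (nat hi - nat M) = hi - M" using M_ge by auto
      then show ?thesis by simp
    qed
    moreover have "(\<Sum>i < nat hi. F i) = (\<Sum>i < nat M. F i) + (\<Sum>i \<in> {nat M..<nat hi}. F i)"
    proof -
      have "nat M \<le> nat hi" using hi L_M by simp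
      then show ?thesis by (metis lessThan_atLeast0 le0 sum.atLeastLessThan_concat)
    qed
    ultimately have "(\<Sum>i < nat hi. F i) \<le> int q * (2 * M - 1) + (if odd M then M else 0) + (hi - M) * M"
      using low by linarith
    moreover have "(\<Sum>i < nat hi. F i) = (\<Sum>t \<in> {1..hi}. int (card (Q t)))"
      by (rule sum.reindex_bij_witness[where i = "\<lambda>t. nat (hi - t)" and j = "\<lambda>i. hi - int i"])
        (auto simp: F_def)
    moreover have "int (card (SIGMA t:{1..hi}. Q t)) = (\<Sum>t \<in> {1..hi}. int (card (Q t)))"
      using fin by (simp add: card_SigmaI)
    moreover have "int (card R) \<le> int (card ({0 :: int} \<times> {- L..M})) + int (card (SIGMA t:{1..hi}. Q t))"
      unfolding R_def using card_Un_le by (simp only: flip: of_nat_add) (simp only: of_nat_le_iff)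
    moreover have "int (card ({0 :: int} \<times> {- L..M})) = 2 * M"
      using M_ge assms by (simp add: card_cartesian_product)
    ultimately have "int (card R) \<le> 2 * M + int q * (2 * M - 1) + (if odd M then M else 0) + (hi - M) * M"
      by linarith
    also have "\<dots> = (L + M) * M + (M + 1) div 2"
    proof -
      have L: "L = M - 1" and hi': "hi = 2 * M - 2" using assms hi by auto
      from M consider "M = 2 * int q" | "M = 2 * int q + 1" by blast
      then show ?thesis unfolding L hi' by cases (simp_all only:, simp_all add: algebra_simps)
    qed
    finally show ?thesis .
  qed
  ultimately show ?thesis by (intro exI[of _ R]) simp
qed

end

section \<open>The visibility number\<close>

lemma vv_eqI:
  assumes "finite (verts X)"
    and upper: "\<And>x S. x \<in> verts X \<Longrightarrow> visibility_set X x S \<Longrightarrow> card S \<le> m"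
    and "\<exists>x \<in> verts X. \<exists>S. visibility_set X x S \<and> card S = m"
  shows "vv X = m"
proof -
  have empty: "visibility_set X x {}" for x by (simp add: visibility_set_def)
  have sub: "{card S |S. visibility_set X x S} \<subseteq> {..m}" if "x \<in> verts X" for x
    using upper[OF that] by blast
  then have fin: "finite {card S |S. visibility_set X x S}" if "x \<in> verts X" for x
    using that by (meson finite_atMost finite_subset)
  have le: "visibility_number_at X x \<le> m" if "x \<in> verts X" for x
  proof -
    have "{card S |S. visibility_set X x S} \<noteq> {}" using empty by blast
    then have "visibility_number_at X x \<in> {card S |S. visibility_set X x S}"
      unfolding visibility_number_at_def by (rule Max_in[OF fin[OF that]])
    then show ?thesis using sub[OF that] by blast
  qed
  obtain x S where x: "x \<in> verts X" "visibility_set X x S" "card S = m" using assms(3) by blast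
  then have "m \<le> visibility_number_at X x"
    unfolding visibility_number_at_def by (intro Max_ge fin) blast+
  then have "visibility_number_at X x = m" using le[OF x(1)] by simp
  then show ?thesis
    unfolding vv_def using x(1) le assms(1) by (intro Max_eqI) auto
qed

text \<open>This is the size of the complement of a largest visibility set. It is kept in terms of
  \<open>M\<close>, as the counts produce it, until the residue of \<open>n\<close> modulo 4 is
  fixed.\<close>

definition blocking_number :: "nat \<Rightarrow> int" where
  "blocking_number n = (let M = int (n div 2) in
    if odd n then if even M then 2 * M * (M + 1) - 1 else 2 * M * M + M + 1
    else (int n - 1) * M + (M + 1) div 2)"

lemma visibility_set_card_le:
  assumes "n \<ge> 4" "r < n" "c < n" "visibility_set (with_proj (path_graph n \<box> cycle_graph n)) (r, c) S"
  shows "int (card S) + blocking_number n \<le> int n * int n"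
proof -
  define \<sigma> :: int where "\<sigma> = (if 2 * r < n then 1 else - 1)"
  interpret g: rooted_grid n r c \<sigma>
    using assms by unfold_locales (auto simp: \<sigma>_def)
  have "g.lo \<le> g.hi" unfolding g.lo_def g.hi_def by (auto simp: \<sigma>_def)
  then interpret b: box g.L g.M g.lo g.hi
    using g.L_M g.lo_hi assms(1) by unfold_locales linarith+
  obtain f T where T: "T \<subseteq> g.Z" "card T = card S" and f: "\<forall>z \<in> g.Z - {(0, 0)}. f z \<in> g.Z - T \<and>
      (\<forall>w \<in> g.Z - {(0, 0)}. f z = f w \<longrightarrow> z \<noteq> w \<longrightarrow> child g.L g.M (f z) z)"
    using g.visibility_set_charging_coord[OF assms(4)] by (elim exE conjE)
  have "int (card T) + (if g.M = g.L then if even g.M then 2 * g.M * (g.M + 1) - 1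
      else 2 * g.M * g.M + g.M + 1 else (g.L + g.M) * g.M + (g.M + 1) div 2)
      \<le> (g.L + g.M + 1) * (g.L + g.M + 1)"
  proof (rule b.box_bound[where f = f])
    show "T \<subseteq> g.Z" by (fact T(1))
    show "f z \<in> g.Z - T" if "z \<in> g.Z - {(0, 0)}" for z using f that by metis
    show "child g.L g.M (f z) z"
      if "z \<in> g.Z - {(0, 0)}" "w \<in> g.Z - {(0, 0)}" "f z = f w" "z \<noteq> w" for z w
      using f that by metis
  qed
  moreover have "blocking_number n = (if g.M = g.L then if even g.M then 2 * g.M * (g.M + 1) - 1
      else 2 * g.M * g.M + g.M + 1 else (g.L + g.M) * g.M + (g.M + 1) div 2)"
  proof -
    have parity: "odd n \<longleftrightarrow> g.M = g.L"
      using assms(1) unfolding g.M_def g.L_def of_nat_eq_iff by presburger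
    have M: "int (n div 2) = g.M" "int n - 1 = g.L + g.M"
      using g.L_M(1) by (simp_all add: g.M_def)
    show ?thesis by (simp only: blocking_number_def Let_def parity M)
  qed
  moreover have "g.L + g.M + 1 = int n" by (fact g.L_M(1))
  ultimately show ?thesis using T(2) by simp
qed

lemma ex_visibility_set_card_ge:
  assumes "n \<ge> 4"
  shows "\<exists>S. visibility_set (with_proj (path_graph n \<box> cycle_graph n)) (1, 0) S \<and>
    int n * int n \<le> int (card S) + blocking_number n"
proof -
  interpret g: rooted_grid n 1 0 1
    using assms by unfold_locales auto
  have lo: "g.lo = 1" unfolding g.lo_def by simp
  interpret b: box1 g.L g.M g.hi
    using g.L_M g.lo_hi assms lo by unfold_locales linarith+
  have M: "g.M = int (n div 2)" "g.L + g.M = int n - 1"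
    using g.L_M(1) by (simp_all add: g.M_def)
  have parity: "g.M = g.L \<longleftrightarrow> odd n"
    using assms unfolding g.M_def g.L_def of_nat_eq_iff by presburger
  have "\<exists>R \<subseteq> b.Z. (0, 0) \<in> R \<and> (\<forall>z \<in> b.Z. z \<noteq> (0, 0) \<longrightarrow> (\<exists>u \<in> R. child g.L g.M u z)) \<and>
      int (card R) \<le> blocking_number n"
  proof (cases "odd n")
    case True
    then have "g.M = g.L" using parity by simp
    show ?thesis
    proof (cases "even g.M")
      case True
      then show ?thesis using b.even_rows_cover[OF \<open>g.M = g.L\<close>] \<open>odd n\<close>
        by (simp only: blocking_number_def Let_def M(1)[symmetric] not_False_eq_True if_True)
    next
      case False
      then show ?thesis using b.even_columns_cover[OF \<open>g.M = g.L\<close>] \<open>odd n\<close>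
        by (simp only: blocking_number_def Let_def M(1)[symmetric] not_False_eq_True if_True if_False)
    qed
  next
    case False
    then have "g.M = g.L + 1" using parity g.L_M(2) by auto
    then show ?thesis using b.staircase_cover False
      by (simp only: blocking_number_def Let_def M[symmetric] not_not not_True_eq_False if_False)
  qed
  then obtain R where R: "R \<subseteq> g.Z" "(0, 0) \<in> R" "\<And>z. z \<in> g.Z \<Longrightarrow> z \<noteq> (0, 0) \<Longrightarrow> \<exists>u \<in> R. child g.L g.M u z"
      and card: "int (card R) \<le> blocking_number n"
    unfolding lo by metis
  obtain S where S: "visibility_set g.G (1, 0) S" "card S + card R = n * n"
    using g.visibility_set_if_children_cover[OF R] by blast
  then have "int n * int n = int (card S) + int (card R)" by (metis of_nat_add of_nat_mult)
  then show ?thesis using S(1) card by (intro exI[of _ S]) auto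
qed

theorem theorem4p3:
  fixes n :: nat
  assumes "n \<ge> 4"
  shows "real (vv (with_proj (path_graph n \<box> cycle_graph n))) =
    (if n mod 4 = 1 then ((real n)\<^sup>2 + 3) / 2
     else if n mod 4 = 3 then ((real n)\<^sup>2 + real n - 2) / 2
     else if n mod 4 = 0 then (2 * (real n)\<^sup>2 + real n) / 4
     else (2 * (real n)\<^sup>2 + real n - 2) / 4)"
proof -
  let ?G = "with_proj (path_graph n \<box> cycle_graph n)"
  have verts: "verts ?G = {..<n} \<times> {..<n}"
    by (auto simp: cartesian_product_def path_graph_def cycle_graph_def)
  obtain S where S: "visibility_set ?G (1, 0) S" "int n * int n \<le> int (card S) + blocking_number n"
    using ex_visibility_set_card_ge[OF assms] by blast
  have upper: "int (card T) \<le> int n * int n - blocking_number n"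
    if "x \<in> verts ?G" "visibility_set ?G x T" for x T
    using visibility_set_card_le[OF assms, of "fst x" "snd x" T] that unfolding verts by auto
  have root: "(1, 0) \<in> verts ?G" unfolding verts using assms by simp
  have card_S: "int (card S) = int n * int n - blocking_number n"
    using S upper[OF root S(1)] by linarith
  have "vv ?G = card S"
  proof (rule vv_eqI)
    show "finite (verts ?G)" unfolding verts by simp
    show "card T \<le> card S" if "x \<in> verts ?G" "visibility_set ?G x T" for x T
      using upper[OF that] card_S by linarith
  qed (use root S(1) in blast)
  then have vv: "real (vv ?G) = real_of_int (int n * int n - blocking_number n)"
    using card_S by (metis of_int_of_nat_eq)
  define j where "j = n div 4"
  have "n = 4 * j + n mod 4" by (simp add: j_def)
  moreover have "n mod 4 \<in> {0, 1, 2, 3}" by auto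
  ultimately consider "n mod 4 = 0" "n = 4 * j" | "n mod 4 = 1" "n = 4 * j + 1"
    | "n mod 4 = 2" "n = 4 * j + 2" | "n mod 4 = 3" "n = 4 * j + 3"
    by force
  then show ?thesis
  proof cases
    case 1
    then have "n div 2 = 2 * j" "even n" "(2 * int j + 1) div 2 = int j" by simp_all
    then have b: "blocking_number n = (4 * int j - 1) * (2 * int j) + int j"
      using 1(2) by (simp add: blocking_number_def)
    show ?thesis unfolding vv b using 1 by (simp add: power2_eq_square field_simps)
  next
    case 2
    then have "n div 2 = 2 * j" "odd n" by simp_all
    then have b: "blocking_number n = 2 * (2 * int j) * (2 * int j + 1) - 1"
      by (simp add: blocking_number_def)
    show ?thesis unfolding vv b using 2 by (simp add: power2_eq_square field_simps)
  next
    case 3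
    then have "n div 2 = 2 * j + 1" "even n" "(2 * int j + 1 + 1) div 2 = int j + 1" by simp_all
    then have b: "blocking_number n = (4 * int j + 1) * (2 * int j + 1) + (int j + 1)"
      using 3(2) by (simp add: blocking_number_def add.commute)
    show ?thesis unfolding vv b using 3 by (simp add: power2_eq_square field_simps)
  next
    case 4
    then have "n div 2 = 2 * j + 1" "odd n" by simp_all
    then have b: "blocking_number n = 2 * (2 * int j + 1) * (2 * int j + 1) + (2 * int j + 1) + 1"
      by (simp add: blocking_number_def add.commute)
    show ?thesis unfolding vv b using 4 by (simp add: power2_eq_square field_simps)
  qed
qed

end
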